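(* Let $P\in\mathcal{U}(\mathfrak{gl}_k)$ be an element of length $L$, and suppose there is an algebraic circuit of size $s$ computing a metapolynomial $\Delta\colon\mathbb{C}[x_1,\dots,x_k]_d\to\mathbb{C}$. Then there exists an algebraic circuit of size $O\big(sL^{2k^2}\big)$ computing $P.\Delta$.
   Context: Metapolynomials are polynomials in variables $c_\mu$, $\mu\in\mathbb{N}^k$, $|\mu|=d$, evaluated at $f\in\mathbb{C}[x_1,\dots,x_k]_d$ by substituting for $c_\mu$ the coefficient of $x^\mu$ in $f$. The Lie algebra $\mathfrak{gl}_k$ (all $k\times k$ complex matrices, bracket $[X,Y]=XY-YX$) acts on metapolynomials by derivations: $E_{i,j}.\Delta=\sum_\mu(E_{i,j}.c_\mu)\partial\Delta/\partial c_\mu$, where $E_{i,j}$ are elementary matrices, $E_{i,j}.c_\mu=(\mu_i+1)c_{\mu+e_i-e_j}$ for $i\ne j$ (zero if $\mu_j=0$) and $E_{i,i}.c_\mu=\mu_ic_\mu$. The universal enveloping algebra $\mathcal{U}(\mathfrak{gl}_k)$ is the tensor algebra $\bigoplus_{m\ge0}\mathfrak{gl}_k^{\otimes m}$ modulo the ideal generated by $X\otimes Y-Y\otimes X-[X,Y]$; it acts by $(Y_1\cdots Y_\ell).\Delta=Y_1.(\cdots(Y_\ell.\Delta))$. The length of $P$ is the minimal $\ell$ such that $P$ is the image of an element of $\bigoplus_{m\le\ell}\mathfrak{gl}_k^{\otimes m}$. An algebraic circuit is a directed acyclic graph with a unique outdegree-$0$ vertex, indegree-$0$ vertices labelled by affine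 linear metapolynomials, indegree-$2$ vertices labelled $+$ or $\times$, and edges labelled by complex scalars; a gate computes $\alpha_1\Delta_1+\alpha_2\Delta_2$ or $\alpha_1\alpha_2\Delta_1\Delta_2$ from its children's values and edge labels, and the circuit computes the value at the output. Its size is its number of vertices.
   Formalization: The bound is proved with max(1, L) in place of L: for L = 0 (P a scalar, k ≥ 1) the literal bound s·0^{2k²} = 0 is impossible, since every circuit has at least one vertex; for L ≥ 1 nothing changes. *)

theory Defs
  imports
    Complex_Main
    "HOL-Library.Poly_Mapping"
    "HOL-Algebra.QuotRing"
    "Jordan_Normal_Form.Matrix"
    "Graph_Theory.Digraph"
begin

section \<open>Metapolynomials\<close>

text \<open>
  An exponent vector \<open>\<mu>\<close> is a finitely supported function; a metapolynomial is a polynomial whose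
  variables \<open>c\<^sub>\<mu>\<close> are indexed by exponent vectors. The variables \<open>x\<^sub>1, \<dots>, x\<^sub>k\<close> are indexed from \<open>0\<close>.
\<close>

type_synonym expo = "nat \<Rightarrow>\<^sub>0 nat"
type_synonym metapoly = "(expo \<Rightarrow>\<^sub>0 nat) \<Rightarrow>\<^sub>0 complex"

definition expos :: "nat \<Rightarrow> nat \<Rightarrow> expo set" where
  "expos k d = {\<mu>. Poly_Mapping.keys \<mu> \<subseteq> {..<k} \<and> (\<Sum>i<k. Poly_Mapping.lookup \<mu> i) = d}"

definition metapolys :: "nat \<Rightarrow> nat \<Rightarrow> metapoly set" where
  "metapolys k d = {\<Delta>. \<forall>m\<in>Poly_Mapping.keys \<Delta>. Poly_Mapping.keys m \<subseteq> expos k d}"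

definition Const :: "complex \<Rightarrow> metapoly" where
  "Const a = Poly_Mapping.single 0 a"

definition cvar :: "expo \<Rightarrow> metapoly" where
  "cvar \<mu> = Poly_Mapping.single (Poly_Mapping.single \<mu> 1) 1"

definition affine_metapolys :: "nat \<Rightarrow> nat \<Rightarrow> metapoly set" where
  "affine_metapolys k d = {Const b + (\<Sum>\<mu>\<in>expos k d. Const (a \<mu>) * cvar \<mu>) | a b. True}"

definition pdiff :: "expo \<Rightarrow> metapoly \<Rightarrow> metapoly" where
  "pdiff \<mu> \<Delta> = (\<Sum>m\<in>Poly_Mapping.keys \<Delta>.
     Poly_Mapping.single (m - Poly_Mapping.single \<mu> 1) (of_nat (Poly_Mapping.lookup m \<mu>) * Poly_Mapping.lookup \<Delta> m))"

definition E_cvar :: "nat \<Rightarrow> nat \<Rightarrow> expo \<Rightarrow> metapoly" where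
  "E_cvar i j \<mu> =
    (if i = j then Const (of_nat (Poly_Mapping.lookup \<mu> i)) * cvar \<mu>
     else if Poly_Mapping.lookup \<mu> j = 0 then 0
     else Const (of_nat (Poly_Mapping.lookup \<mu> i + 1)) *
            cvar (\<mu> + Poly_Mapping.single i 1 - Poly_Mapping.single j 1))"

definition E_act :: "nat \<Rightarrow> nat \<Rightarrow> nat \<Rightarrow> nat \<Rightarrow> metapoly \<Rightarrow> metapoly" where
  "E_act k d i j \<Delta> = (\<Sum>\<mu>\<in>expos k d. E_cvar i j \<mu> * pdiff \<mu> \<Delta>)"


section \<open>The universal enveloping algebra of \<open>gl\<^sub>k\<close>\<close>

text \<open>
  Words under concatenation, so that \<open>'a list \<Rightarrow>\<^sub>0 complex\<close> carries the (noncommutative)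
  convolution product. With letters \<open>(i, j)\<close>, \<open>i, j < k\<close>, this is the tensor algebra of \<open>gl\<^sub>k\<close>:
  the word \<open>[(i\<^sub>1, j\<^sub>1), \<dots>, (i\<^sub>m, j\<^sub>m)]\<close> stands for the basis vector
  \<open>E\<^bsub>i\<^sub>1,j\<^sub>1\<^esub> \<otimes> \<dots> \<otimes> E\<^bsub>i\<^sub>m,j\<^sub>m\<^esub>\<close> of the \<open>m\<close>-th tensor power.
\<close>

instantiation list :: (type) monoid_add
begin
definition zero_list :: "'a list" where "zero_list = []"
definition plus_list :: "'a list \<Rightarrow> 'a list \<Rightarrow> 'a list" where "plus_list = (@)"
instance by standard (simp_all add: zero_list_def plus_list_def)
end

type_synonym tensor = "(nat \<times> nat) list \<Rightarrow>\<^sub>0 complex"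

definition tensor_alg :: "nat \<Rightarrow> tensor ring" where
  "tensor_alg k =
    \<lparr>carrier = {t. \<forall>w\<in>Poly_Mapping.keys t. set w \<subseteq> {..<k} \<times> {..<k}},
     monoid.mult = (*), one = 1, zero = 0, add = (+)\<rparr>"

definition gl_tensor :: "complex mat \<Rightarrow> tensor" where
  "gl_tensor X = (\<Sum>i<dim_row X. \<Sum>j<dim_col X. Poly_Mapping.single [(i, j)] (X $$ (i, j)))"

definition uea_ideal :: "nat \<Rightarrow> tensor set" where
  "uea_ideal k = genideal (tensor_alg k)
    {gl_tensor X * gl_tensor Y - gl_tensor Y * gl_tensor X - gl_tensor (X * Y - Y * X) | X Y.
      X \<in> carrier_mat k k \<and> Y \<in> carrier_mat k k}"

definition uea :: "nat \<Rightarrow> tensor set ring" where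
  "uea k = tensor_alg k Quot uea_ideal k"

definition uea_length :: "nat \<Rightarrow> tensor set \<Rightarrow> nat" where
  "uea_length k P = (LEAST l. \<exists>t\<in>carrier (tensor_alg k).
     (\<forall>w\<in>Poly_Mapping.keys t. length w \<le> l) \<and> P = uea_ideal k +>\<^bsub>tensor_alg k\<^esub> t)"

definition tensor_act :: "nat \<Rightarrow> nat \<Rightarrow> tensor \<Rightarrow> metapoly \<Rightarrow> metapoly" where
  "tensor_act k d t \<Delta> =
    (\<Sum>w\<in>Poly_Mapping.keys t. Const (Poly_Mapping.lookup t w) * foldr (\<lambda>(i, j). E_act k d i j) w \<Delta>)"

text \<open>Independence of the representative is \<open>uea_act_eq\<close> below.\<close>

definition uea_act :: "nat \<Rightarrow> nat \<Rightarrow> tensor set \<Rightarrow> metapoly \<Rightarrow> metapoly" where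
  "uea_act k d P \<Delta> = tensor_act k d (SOME t. t \<in> P) \<Delta>"


section \<open>Algebraic circuits\<close>

datatype gate_label = Input metapoly | Plus | Times

text \<open>Parallel arcs are allowed: both inputs of a gate may come from the same vertex.\<close>

record circuit =
  dag :: "(nat, nat) pre_digraph"
  gate :: "nat \<Rightarrow> gate_label"
  scalar :: "nat \<Rightarrow> complex"

definition is_circuit :: "nat \<Rightarrow> nat \<Rightarrow> circuit \<Rightarrow> bool" where
  "is_circuit k d C \<longleftrightarrow>
     fin_digraph (dag C) \<and> acyclic (arcs_ends (dag C)) \<and>
     (\<exists>!v. v \<in> verts (dag C) \<and> out_degree (dag C) v = 0) \<and>
     (\<forall>v\<in>verts (dag C).
        case gate C v of
          Input A \<Rightarrow> in_degree (dag C) v = 0 \<and> A \<in> affine_metapolys k d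
        | Plus \<Rightarrow> in_degree (dag C) v = 2
        | Times \<Rightarrow> in_degree (dag C) v = 2)"

definition gate_values :: "circuit \<Rightarrow> (nat \<Rightarrow> metapoly) \<Rightarrow> bool" where
  "gate_values C val \<longleftrightarrow>
     (\<forall>v\<in>verts (dag C).
        val v = (case gate C v of
          Input A \<Rightarrow> A
        | Plus \<Rightarrow> (\<Sum>e\<in>in_arcs (dag C) v. Const (scalar C e) * val (tail (dag C) e))
        | Times \<Rightarrow> (\<Prod>e\<in>in_arcs (dag C) v. Const (scalar C e) * val (tail (dag C) e))))"

definition computes :: "circuit \<Rightarrow> metapoly \<Rightarrow> bool" where
  "computes C \<Delta> \<longleftrightarrow>
     (\<exists>val. gate_values C val \<and>
        (\<exists>v\<in>verts (dag C). out_degree (dag C) v = 0 \<and> val v = \<Delta>))"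

definition circuit_size :: "circuit \<Rightarrow> nat" where
  "circuit_size C = card (verts (dag C))"


section \<open>Well-definedness of the action\<close>

lemma tensor_alg_ring: "ring (tensor_alg k)"
proof (rule ringI)
  show "abelian_group (tensor_alg k)"
  proof (rule abelian_groupI)
    fix x assume "x \<in> carrier (tensor_alg k)"
    then show "\<exists>y\<in>carrier (tensor_alg k). y \<oplus>\<^bsub>tensor_alg k\<^esub> x = \<zero>\<^bsub>tensor_alg k\<^esub>"
      by (intro bexI[of _ "- x"]) (auto simp: tensor_alg_def in_keys_iff)
  qed (use keys_add in \<open>force simp: tensor_alg_def add_ac\<close>)+
  show "Group.monoid (tensor_alg k)"
  proof (rule monoidI)
    fix x y assume "x \<in> carrier (tensor_alg k)" "y \<in> carrier (tensor_alg k)"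
    then show "x \<otimes>\<^bsub>tensor_alg k\<^esub> y \<in> carrier (tensor_alg k)"
      using keys_mult[of x y] by (fastforce simp: tensor_alg_def plus_list_def)
  qed (simp_all add: tensor_alg_def mult.assoc zero_list_def)
qed (simp_all add: tensor_alg_def algebra_simps)

lemma poly_mapping_single_add_induct:
  fixes p :: "'a \<Rightarrow>\<^sub>0 'b::comm_monoid_add"
  assumes single: "\<And>m a. Q (Poly_Mapping.single m a)"
    and add: "\<And>p q. Q p \<Longrightarrow> Q q \<Longrightarrow> Q (p + q)"
  shows "Q p"
proof (induction p rule: update_induct)
  case const
  show ?case using single[of undefined 0] by simp
next
  case (update p m a)
  have "Poly_Mapping.update m a p = Poly_Mapping.single m a + p"
    using update(1)
    by (intro poly_mapping_eqI) (auto simp: lookup_update lookup_add lookup_single in_keys_iff when_def)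
  then show ?case using add single update by metis
qed

lemma pdiff_superset:
  assumes "finite S" "Poly_Mapping.keys \<Delta> \<subseteq> S"
  shows "pdiff \<mu> \<Delta> = (\<Sum>m\<in>S. Poly_Mapping.single (m - Poly_Mapping.single \<mu> 1)
     (of_nat (Poly_Mapping.lookup m \<mu>) * Poly_Mapping.lookup \<Delta> m))"
  unfolding pdiff_def
  by (rule sum.mono_neutral_left) (use assms in \<open>auto simp: in_keys_iff\<close>)

lemma pdiff_add: "pdiff \<mu> (p + q) = pdiff \<mu> p + pdiff \<mu> q"
proof -
  let ?S = "Poly_Mapping.keys p \<union> Poly_Mapping.keys q"
  have "pdiff \<mu> r = (\<Sum>m\<in>?S. Poly_Mapping.single (m - Poly_Mapping.single \<mu> 1)
     (of_nat (Poly_Mapping.lookup m \<mu>) * Poly_Mapping.lookup r m))" if "r \<in> {p, q, p + q}" for r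
    by (rule pdiff_superset) (use that keys_add[of p q] in auto)
  then show ?thesis
    by (simp add: lookup_add distrib_left single_add sum.distrib)
qed

lemma pdiff_single:
  "pdiff \<mu> (Poly_Mapping.single m a) =
    Poly_Mapping.single (m - Poly_Mapping.single \<mu> 1) (of_nat (Poly_Mapping.lookup m \<mu>) * a)"
  by (subst pdiff_superset[of "{m}"]) auto

lemma pdiff_mult: "pdiff \<mu> (p * q) = pdiff \<mu> p * q + p * pdiff \<mu> q"
proof (induction p rule: poly_mapping_single_add_induct)
  case p: (1 m a)
  show ?case
  proof (induction q rule: poly_mapping_single_add_induct)
    case (1 n b)
    let ?e = "Poly_Mapping.single \<mu> (1::nat)"
    have shift: "m' + n' - ?e = (m' - ?e) + n'" if "Poly_Mapping.lookup m' \<mu> \<noteq> 0" for m' n'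
      using that by (intro poly_mapping_eqI) (auto simp: lookup_add lookup_minus lookup_single when_def)
    have l: "Poly_Mapping.single (m + n - ?e) (of_nat (Poly_Mapping.lookup m \<mu>) * (a * b)) =
       Poly_Mapping.single (m - ?e + n) (of_nat (Poly_Mapping.lookup m \<mu>) * (a * b))"
      using shift[of m n] by (cases "Poly_Mapping.lookup m \<mu> = 0") auto
    have r: "Poly_Mapping.single (m + n - ?e) (of_nat (Poly_Mapping.lookup n \<mu>) * (a * b)) =
       Poly_Mapping.single (m + (n - ?e)) (of_nat (Poly_Mapping.lookup n \<mu>) * (a * b))"
      using shift[of n m] by (cases "Poly_Mapping.lookup n \<mu> = 0") (auto simp: add.commute)
    have "pdiff \<mu> (Poly_Mapping.single m a * Poly_Mapping.single n b) =
      Poly_Mapping.single (m + n - ?e) (of_nat (Poly_Mapping.lookup m \<mu>) * (a * b)) +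
      Poly_Mapping.single (m + n - ?e) (of_nat (Poly_Mapping.lookup n \<mu>) * (a * b))"
      by (simp add: mult_single pdiff_single lookup_add distrib_right single_add)
    then show ?case unfolding l r by (simp add: mult_single pdiff_single ac_simps)
  next
    case (2 q r)
    then show ?case by (simp add: distrib_left pdiff_add)
  qed
next
  case (2 p q)
  then show ?case by (simp add: distrib_right pdiff_add)
qed

lemma Const_simps:
  "Const 0 = 0" "Const 1 = 1" "Const (a + b) = Const a + Const b"
  "Const (a - b) = Const a - Const b" "Const (a * b) = Const a * Const b"
  "Const (numeral n) = numeral n"
  by (simp_all add: Const_def single_add single_diff mult_single)

lemma Const_sum: "Const (sum f A) = (\<Sum>x\<in>A. Const (f x))"
  by (induction A rule: infinite_finite_induct) (auto simp: Const_simps)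

lemma finite_expos: "finite (expos k d)"
proof -
  have "Poly_Mapping.lookup ` expos k d \<subseteq> {f. \<forall>i. (i \<in> {..<k} \<longrightarrow> f i \<in> {..d}) \<and> (i \<notin> {..<k} \<longrightarrow> f i = 0)}"
  proof clarify
    fix \<mu> i assume mu: "\<mu> \<in> expos k d"
    have "Poly_Mapping.lookup \<mu> i \<le> (\<Sum>i<k. Poly_Mapping.lookup \<mu> i)" if "i < k"
      using that by (intro member_le_sum) auto
    with mu show "(i \<in> {..<k} \<longrightarrow> Poly_Mapping.lookup \<mu> i \<in> {..d}) \<and>
        (i \<notin> {..<k} \<longrightarrow> Poly_Mapping.lookup \<mu> i = 0)"
      by (auto simp: expos_def in_keys_iff)
  qed
  moreover have "finite \<dots>" by (rule finite_set_of_finite_funs) auto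
  ultimately show ?thesis
    by (meson finite_imageD finite_subset inj_onI lookup_inject)
qed

lemma E_act_add: "E_act k d i j (p + q) = E_act k d i j p + E_act k d i j q"
  by (simp add: E_act_def pdiff_add distrib_left sum.distrib)

lemma E_act_mult: "E_act k d i j (p * q) = E_act k d i j p * q + p * E_act k d i j q"
  by (simp add: E_act_def pdiff_mult sum.distrib algebra_simps sum_distrib_left sum_distrib_right)

lemma E_act_Const [simp]: "E_act k d i j (Const a) = 0"
  by (simp add: E_act_def Const_def pdiff_single)

lemma E_act_Const_mult: "E_act k d i j (Const a * p) = Const a * E_act k d i j p"
  by (simp add: E_act_mult)

lemma E_act_0 [simp]: "E_act k d i j 0 = 0"
  using E_act_Const[of k d i j 0] by (simp only: Const_simps)

lemma E_act_cvar: "E_act k d i j (cvar \<mu>) = (if \<mu> \<in> expos k d then E_cvar i j \<mu> else 0)"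
proof -
  have "pdiff \<nu> (cvar \<mu>) = (if \<nu> = \<mu> then 1 else 0)" for \<nu>
    by (auto simp: cvar_def pdiff_single lookup_single when_def)
  then have "E_act k d i j (cvar \<mu>) = (\<Sum>\<nu>\<in>expos k d. if \<nu> = \<mu> then E_cvar i j \<nu> else 0)"
    unfolding E_act_def by (intro sum.cong) auto
  then show ?thesis using finite_expos by (simp add: sum.delta)
qed

lemma derivation_eq_0:
  fixes D :: "metapoly \<Rightarrow> metapoly"
  assumes add: "\<And>p q. D (p + q) = D p + D q"
    and mult: "\<And>p q. D (p * q) = D p * q + p * D q"
    and Const: "\<And>a. D (Const a) = 0"
    and cvar: "\<And>\<mu>. D (cvar \<mu>) = 0"
  shows "D p = 0"
proof (induction p rule: poly_mapping_single_add_induct)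
  case (1 m a)
  have one: "D 1 = 0" using Const[of 1] by (simp add: Const_simps)
  have "D (Poly_Mapping.single m 1) = 0"
  proof (induction m rule: poly_mapping_single_add_induct)
    case (1 \<mu> n)
    show ?case
    proof (induction n)
      case 0
      then show ?case using one by simp
    next
      case (Suc n)
      have "Poly_Mapping.single (Poly_Mapping.single \<mu> (Suc n)) 1 =
          cvar \<mu> * Poly_Mapping.single (Poly_Mapping.single \<mu> n) 1"
        by (simp add: cvar_def mult_single flip: single_add)
      then show ?case by (simp add: mult cvar Suc)
    qed
  next
    case (2 p q)
    have "Poly_Mapping.single (p + q) (1::complex) = Poly_Mapping.single p 1 * Poly_Mapping.single q 1"
      by (simp add: mult_single)
    then show ?case by (simp add: mult 2)
  qed
  moreover have "Poly_Mapping.single m a = Const a * Poly_Mapping.single m 1"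
    by (simp add: Const_def mult_single)
  ultimately show ?case by (simp add: mult Const)
qed (simp add: add)

lemma E_cvar_alt:
  "E_cvar i j \<mu> = (if Poly_Mapping.lookup \<mu> j = 0 then 0
     else Const (of_nat (Poly_Mapping.lookup (\<mu> - Poly_Mapping.single j 1) i + 1)) *
            cvar (\<mu> - Poly_Mapping.single j 1 + Poly_Mapping.single i 1))"
proof (cases "Poly_Mapping.lookup \<mu> j = 0")
  case False
  then have "\<mu> + Poly_Mapping.single i 1 - Poly_Mapping.single j 1 =
      \<mu> - Poly_Mapping.single j 1 + Poly_Mapping.single i 1"
    and "i = j \<Longrightarrow> \<mu> - Poly_Mapping.single j 1 + Poly_Mapping.single i 1 = \<mu>"
    by (intro poly_mapping_eqI; auto simp: lookup_add lookup_minus lookup_single when_def)+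
  with False show ?thesis
    by (auto simp: E_cvar_def lookup_minus lookup_single when_def)
qed (auto simp: E_cvar_def Const_simps)

lemma E_cvar_add:
  "E_cvar i j (\<rho> + Poly_Mapping.single j 1) =
     Const (of_nat (Poly_Mapping.lookup \<rho> i + 1)) * cvar (\<rho> + Poly_Mapping.single i 1)"
  by (simp add: E_cvar_alt lookup_add)

lemma expos_shift:
  assumes "\<rho> + Poly_Mapping.single j 1 \<in> expos k d" "i < k"
  shows "\<rho> + Poly_Mapping.single i 1 \<in> expos k d"
proof -
  have *: "(\<Sum>x<k. Poly_Mapping.lookup (\<rho> + Poly_Mapping.single y 1) x) =
      (\<Sum>x<k. Poly_Mapping.lookup \<rho> x) + 1" if "y < k" for y
    using that by (simp add: lookup_add sum.distrib lookup_single when_def sum.delta)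
  have "j < k"
    using assms(1) by (auto simp: expos_def in_keys_iff lookup_add subset_iff)
  with assms * show ?thesis
    by (auto simp: expos_def in_keys_iff lookup_add subset_iff lookup_single when_def split: if_splits)
qed

lemma E_act_cvar_add:
  assumes "\<rho> + Poly_Mapping.single j 1 \<in> expos k d"
  shows "E_act k d i j (cvar (\<rho> + Poly_Mapping.single j 1)) =
     Const (of_nat (Poly_Mapping.lookup \<rho> i) + 1) * cvar (\<rho> + Poly_Mapping.single i 1)"
  using assms E_cvar_add[of i j \<rho>] by (simp add: E_act_cvar add.commute del: One_nat_def)

lemma E_act_cvar_eq_0:
  "Poly_Mapping.lookup \<mu> j = 0 \<Longrightarrow> E_act k d i j (cvar \<mu>) = 0"
  by (simp add: E_act_cvar E_cvar_alt)

lemma poly_mapping_split_single: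
  fixes \<mu> :: expo
  assumes "Poly_Mapping.lookup \<mu> j \<noteq> 0"
  obtains \<rho> where "\<mu> = \<rho> + Poly_Mapping.single j 1"
proof
  show "\<mu> = \<mu> - Poly_Mapping.single j 1 + Poly_Mapping.single j 1"
    using assms by (intro poly_mapping_eqI) (auto simp: lookup_add lookup_minus lookup_single when_def)
qed

lemma E_act_commutator_cvar_aux:
  assumes mu: "\<rho> + Poly_Mapping.single j 1 \<in> expos k d" and "i < k" "l < k"
  shows "E_act k d i j (E_act k d l m (cvar (\<rho> + Poly_Mapping.single j 1))) -
      E_act k d l m (E_act k d i j (cvar (\<rho> + Poly_Mapping.single j 1))) =
    (if j = l then E_act k d i m (cvar (\<rho> + Poly_Mapping.single j 1)) else 0) -
    (if i = m then E_act k d l j (cvar (\<rho> + Poly_Mapping.single j 1)) else 0)"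
proof -
  let ?e = "\<lambda>x. Poly_Mapping.single x (1::nat)"
  have shift: "\<rho> + ?e a \<in> expos k d" if "a < k" for a
    using expos_shift mu that by blast
  show ?thesis
  proof (cases "Poly_Mapping.lookup \<rho> m = 0")
    case True
    have i: "E_act k d l m (cvar (\<rho> + ?e i)) =
        (if i = m then Const (of_nat (Poly_Mapping.lookup \<rho> l) + 1) * cvar (\<rho> + ?e l) else 0)"
      using E_act_cvar_add[of \<rho> m k d l] shift[of i] assms True
      by (auto intro!: E_act_cvar_eq_0 simp: lookup_add lookup_single when_def)
    have l: "E_act k d i j (cvar (\<rho> + ?e l)) = Const (of_nat (Poly_Mapping.lookup \<rho> i) + 1) * cvar (\<rho> + ?e i)"
      if "l = j" using that E_act_cvar_add[OF mu] by simp
    show ?thesis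
    proof (cases "j = m")
      case j: True
      have l': "E_act k d i j (cvar (\<rho> + ?e l)) = 0" if "l \<noteq> j"
        using that True j by (auto intro!: E_act_cvar_eq_0 simp: lookup_add lookup_single when_def)
      show ?thesis
        using True j mu i l l'
        by (auto simp: E_act_cvar_add E_act_Const_mult Const_simps(1,2) simp del: One_nat_def)
    next
      case False
      then have "E_act k d x m (cvar (\<rho> + ?e j)) = 0" for x
        using True by (auto intro!: E_act_cvar_eq_0 simp: lookup_add lookup_single when_def)
      then show ?thesis
        using True mu i by (auto simp: E_act_cvar_add E_act_Const_mult Const_simps(1,2) simp del: One_nat_def)
    qed
  next
    case False
    then obtain \<sigma> where \<rho>: "\<rho> = \<sigma> + ?e m" by (rule poly_mapping_split_single)
    have A: "E_act k d x m (cvar (\<sigma> + ?e y + ?e m)) =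
        Const (of_nat (Poly_Mapping.lookup (\<sigma> + ?e y) x) + 1) * cvar (\<sigma> + ?e y + ?e x)" if "y < k" for x y
      using E_act_cvar_add[of "\<sigma> + ?e y" m k d x] shift[OF that] by (simp add: \<rho> ac_simps)
    have "j < k"
      using mu by (auto simp: expos_def in_keys_iff lookup_add subset_iff)
    have B: "E_act k d x j (cvar (\<sigma> + ?e y + ?e j)) =
        Const (of_nat (Poly_Mapping.lookup (\<sigma> + ?e y) x) + 1) * cvar (\<sigma> + ?e y + ?e x)" if "y < k \<or> y = m" for x y
    proof -
      have "\<sigma> + ?e y + ?e j \<in> expos k d"
        using that
      proof
        assume "y < k"
        moreover have "\<sigma> + ?e j + ?e m \<in> expos k d" using mu by (simp add: \<rho> ac_simps)
        ultimately show ?thesis using expos_shift[of "\<sigma> + ?e j" m k d y] by (simp add: ac_simps)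
      qed (use mu \<rho> in simp)
      then show ?thesis by (rule E_act_cvar_add)
    qed
    have C: "\<sigma> + ?e m + ?e x = \<sigma> + ?e x + ?e m" for x by (simp add: ac_simps)
    have D: "\<sigma> + ?e j + ?e x = \<sigma> + ?e x + ?e j" for x by (simp add: ac_simps)
    have E: "\<sigma> + ?e l + ?e i = \<sigma> + ?e i + ?e l" by (simp add: ac_simps)
    have 1: "E_act k d i j (E_act k d l m (cvar (\<sigma> + ?e m + ?e j))) =
      Const (of_nat (Poly_Mapping.lookup (\<sigma> + ?e j) l) + 1) *
      (Const (of_nat (Poly_Mapping.lookup (\<sigma> + ?e l) i) + 1) * cvar (\<sigma> + ?e i + ?e l))"
      unfolding C[of j] A[OF \<open>j < k\<close>] E_act_Const_mult D[of l] using B[of l i] assms E by simp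
    have 2: "E_act k d l m (E_act k d i j (cvar (\<sigma> + ?e m + ?e j))) =
      Const (of_nat (Poly_Mapping.lookup (\<sigma> + ?e m) i) + 1) *
      (Const (of_nat (Poly_Mapping.lookup (\<sigma> + ?e i) l) + 1) * cvar (\<sigma> + ?e i + ?e l))"
      using B[of m i] A[of i l] assms C[of i] by (simp add: E_act_Const_mult)
    have 3: "E_act k d i m (cvar (\<sigma> + ?e m + ?e j)) =
      Const (of_nat (Poly_Mapping.lookup (\<sigma> + ?e j) i) + 1) * cvar (\<sigma> + ?e i + ?e j)"
      unfolding C[of j] A[OF \<open>j < k\<close>] D[of i] ..
    have 4: "E_act k d l j (cvar (\<sigma> + ?e m + ?e j)) =
      Const (of_nat (Poly_Mapping.lookup (\<sigma> + ?e m) l) + 1) * cvar (\<sigma> + ?e m + ?e l)"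
      using B[of m l] by simp
    show ?thesis
      unfolding \<rho> 1 2 3 4
      by (cases "i = l"; cases "j = l"; cases "i = m")
         (simp_all add: lookup_add lookup_single when_def Const_simps algebra_simps)
  qed
qed

lemma E_act_commutator_cvar:
  assumes "i < k" "l < k" "\<mu> \<in> expos k d"
  shows "E_act k d i j (E_act k d l m (cvar \<mu>)) - E_act k d l m (E_act k d i j (cvar \<mu>)) =
    (if j = l then E_act k d i m (cvar \<mu>) else 0) - (if i = m then E_act k d l j (cvar \<mu>) else 0)"
proof (cases "Poly_Mapping.lookup \<mu> j = 0")
  case j: True
  show ?thesis
  proof (cases "Poly_Mapping.lookup \<mu> m = 0")
    case True
    with j show ?thesis by (simp add: E_act_cvar_eq_0)
  next
    case False
    then obtain \<rho> where "\<mu> = \<rho> + Poly_Mapping.single m 1" by (rule poly_mapping_split_single)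
    with E_act_commutator_cvar_aux[of \<rho> m k d l i j] assms show ?thesis
      by (auto simp: algebra_simps split: if_splits)
  qed
next
  case False
  then obtain \<rho> where "\<mu> = \<rho> + Poly_Mapping.single j 1" by (rule poly_mapping_split_single)
  with E_act_commutator_cvar_aux assms show ?thesis by auto
qed

lemma E_act_commutator:
  assumes "i < k" "l < k"
  shows "E_act k d i j (E_act k d l m p) - E_act k d l m (E_act k d i j p) =
    (if j = l then E_act k d i m p else 0) - (if i = m then E_act k d l j p else 0)"
proof -
  define D where "D p = E_act k d i j (E_act k d l m p) - E_act k d l m (E_act k d i j p)
     - ((if j = l then E_act k d i m p else 0) - (if i = m then E_act k d l j p else 0))" for p
  have "D p = 0"
  proof (rule derivation_eq_0[of D])
    fix \<mu>
    show "D (cvar \<mu>) = 0"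
    proof (cases "\<mu> \<in> expos k d")
      case True
      then show ?thesis
        unfolding D_def E_act_commutator_cvar[OF assms True] by simp
    qed (simp add: D_def E_act_cvar)
  qed (auto simp: D_def E_act_add E_act_mult algebra_simps)
  then show ?thesis by (simp add: D_def)
qed

abbreviation word_act :: "nat \<Rightarrow> nat \<Rightarrow> (nat \<times> nat) list \<Rightarrow> metapoly \<Rightarrow> metapoly" where
  "word_act k d w \<equiv> foldr (\<lambda>(i, j). E_act k d i j) w"

lemma word_act_add: "word_act k d w (p + q) = word_act k d w p + word_act k d w q"
  by (induction w) (auto simp: E_act_add)

lemma word_act_Const_mult: "word_act k d w (Const a * p) = Const a * word_act k d w p"
  by (induction w) (auto simp: E_act_Const_mult)

lemma tensor_act_superset:
  assumes "finite S" "Poly_Mapping.keys t \<subseteq> S"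
  shows "tensor_act k d t \<Delta> = (\<Sum>w\<in>S. Const (Poly_Mapping.lookup t w) * word_act k d w \<Delta>)"
  unfolding tensor_act_def
  by (rule sum.mono_neutral_left) (use assms in \<open>auto simp: in_keys_iff Const_simps\<close>)

lemma tensor_act_add: "tensor_act k d (s + t) \<Delta> = tensor_act k d s \<Delta> + tensor_act k d t \<Delta>"
proof -
  let ?S = "Poly_Mapping.keys s \<union> Poly_Mapping.keys t"
  have "tensor_act k d r \<Delta> = (\<Sum>w\<in>?S. Const (Poly_Mapping.lookup r w) * word_act k d w \<Delta>)"
    if "r \<in> {s, t, s + t}" for r
    by (rule tensor_act_superset) (use that keys_add[of s t] in auto)
  then show ?thesis
    by (simp add: lookup_add Const_simps distrib_right sum.distrib)
qed

lemma tensor_act_single: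
  "tensor_act k d (Poly_Mapping.single w a) \<Delta> = Const a * word_act k d w \<Delta>"
  by (subst tensor_act_superset[of "{w}"]) auto

lemma tensor_act_0 [simp]: "tensor_act k d 0 \<Delta> = 0"
  by (simp add: tensor_act_def)

lemma tensor_act_diff: "tensor_act k d (s - t) \<Delta> = tensor_act k d s \<Delta> - tensor_act k d t \<Delta>"
  using tensor_act_add[of k d "s - t" t \<Delta>] by (simp add: algebra_simps)

lemma tensor_act_sum: "tensor_act k d (sum f A) \<Delta> = (\<Sum>x\<in>A. tensor_act k d (f x) \<Delta>)"
  by (induction A rule: infinite_finite_induct) (auto simp: tensor_act_add)

lemma tensor_act_arg_add:
  "tensor_act k d t (p + q) = tensor_act k d t p + tensor_act k d t q"
  by (simp add: tensor_act_def word_act_add distrib_left sum.distrib)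

lemma tensor_act_arg_Const_mult:
  "tensor_act k d t (Const a * p) = Const a * tensor_act k d t p"
  by (simp add: tensor_act_def word_act_Const_mult sum_distrib_left mult.left_commute)

lemma tensor_act_arg_0 [simp]: "tensor_act k d t 0 = 0"
  using tensor_act_arg_add[of k d t 0 0] by simp

lemma tensor_act_mult:
  "tensor_act k d (s * t) \<Delta> = tensor_act k d s (tensor_act k d t \<Delta>)"
proof (induction s rule: poly_mapping_single_add_induct)
  case s: (1 v a)
  show ?case
  proof (induction t rule: poly_mapping_single_add_induct)
    case (1 w b)
    then show ?case
      by (simp add: mult_single tensor_act_single plus_list_def word_act_Const_mult Const_simps ac_simps)
  qed (simp add: distrib_left tensor_act_add tensor_act_arg_add)
qed (simp add: distrib_right tensor_act_add)

lemma tensor_act_gl_tensor: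
  assumes "X \<in> carrier_mat k k"
  shows "tensor_act k d (gl_tensor X) \<Delta> = (\<Sum>i<k. \<Sum>j<k. Const (X $$ (i, j)) * E_act k d i j \<Delta>)"
  using assms by (simp add: gl_tensor_def tensor_act_sum tensor_act_single)

lemma E_act_sum: "E_act k d i j (sum f A) = (\<Sum>x\<in>A. E_act k d i j (f x))"
  by (induction A rule: infinite_finite_induct) (auto simp: E_act_add)

lemma sum_swap3:
  "(\<Sum>x\<in>A. \<Sum>y\<in>B. \<Sum>z\<in>C. f x y z) = (\<Sum>y\<in>B. \<Sum>z\<in>C. \<Sum>x\<in>A. f x y z)"
  by (subst sum.swap) (rule sum.cong[OF refl], rule sum.swap)

lemma tensor_act_relation:
  assumes X: "X \<in> carrier_mat k k" and Y: "Y \<in> carrier_mat k k"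
  shows "tensor_act k d
    (gl_tensor X * gl_tensor Y - gl_tensor Y * gl_tensor X - gl_tensor (X * Y - Y * X)) \<Delta> = 0"
proof -
  let ?E = "\<lambda>i j. E_act k d i j"
  have XY: "tensor_act k d (gl_tensor X * gl_tensor Y) \<Delta> =
    (\<Sum>i<k. \<Sum>j<k. \<Sum>l<k. \<Sum>m<k. Const (X $$ (i, j) * Y $$ (l, m)) * ?E i j (?E l m \<Delta>))"
    unfolding tensor_act_mult tensor_act_gl_tensor[OF X] tensor_act_gl_tensor[OF Y]
    by (simp add: E_act_sum E_act_Const_mult sum_distrib_left Const_simps mult.assoc)
  have "tensor_act k d (gl_tensor Y * gl_tensor X) \<Delta> =
    (\<Sum>l<k. \<Sum>m<k. \<Sum>i<k. \<Sum>j<k. Const (X $$ (i, j) * Y $$ (l, m)) * ?E l m (?E i j \<Delta>))"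
    unfolding tensor_act_mult tensor_act_gl_tensor[OF X] tensor_act_gl_tensor[OF Y]
    by (simp add: E_act_sum E_act_Const_mult sum_distrib_left Const_simps ac_simps)
  also have "\<dots> = (\<Sum>l<k. \<Sum>i<k. \<Sum>j<k. \<Sum>m<k. Const (X $$ (i, j) * Y $$ (l, m)) * ?E l m (?E i j \<Delta>))"
    by (rule sum.cong[OF refl], rule sum_swap3)
  also have "\<dots> = (\<Sum>i<k. \<Sum>j<k. \<Sum>l<k. \<Sum>m<k. Const (X $$ (i, j) * Y $$ (l, m)) * ?E l m (?E i j \<Delta>))"
    by (rule sum_swap3)
  finally have YX: "tensor_act k d (gl_tensor Y * gl_tensor X) \<Delta> = \<dots>" .
  have "tensor_act k d (gl_tensor X * gl_tensor Y) \<Delta> - tensor_act k d (gl_tensor Y * gl_tensor X) \<Delta> =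
    (\<Sum>i<k. \<Sum>j<k. \<Sum>l<k. \<Sum>m<k. Const (X $$ (i, j) * Y $$ (l, m)) *
       (?E i j (?E l m \<Delta>) - ?E l m (?E i j \<Delta>)))"
    unfolding XY YX by (simp add: right_diff_distrib sum_subtractf)
  also have "\<dots> = (\<Sum>i<k. \<Sum>j<k. \<Sum>l<k. \<Sum>m<k. Const (X $$ (i, j) * Y $$ (l, m)) *
       ((if j = l then ?E i m \<Delta> else 0) - (if i = m then ?E l j \<Delta> else 0)))"
    by (intro sum.cong refl) (simp add: E_act_commutator)
  also have "\<dots> = (\<Sum>i<k. \<Sum>j<k. \<Sum>l<k. \<Sum>m<k. if j = l then Const (X $$ (i, j) * Y $$ (l, m)) * ?E i m \<Delta> else 0) -
    (\<Sum>i<k. \<Sum>j<k. \<Sum>l<k. \<Sum>m<k. if m = i then Const (X $$ (i, j) * Y $$ (l, m)) * ?E l j \<Delta> else 0)"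
    unfolding sum_subtractf[symmetric]
    by (intro sum.cong refl) (auto simp: right_diff_distrib)
  also have "(\<Sum>i<k. \<Sum>j<k. \<Sum>l<k. \<Sum>m<k. if j = l then Const (X $$ (i, j) * Y $$ (l, m)) * ?E i m \<Delta> else 0) =
    (\<Sum>i<k. \<Sum>j<k. \<Sum>m<k. Const (X $$ (i, j) * Y $$ (j, m)) * ?E i m \<Delta>)"
    by (rule sum.cong[OF refl], rule sum.cong[OF refl], subst sum.swap) (simp add: sum.delta)
  also have "\<dots> = (\<Sum>i<k. \<Sum>m<k. \<Sum>j<k. Const (X $$ (i, j) * Y $$ (j, m)) * ?E i m \<Delta>)"
    by (rule sum.cong[OF refl], rule sum.swap)
  also have "\<dots> = (\<Sum>i<k. \<Sum>m<k. Const ((X * Y) $$ (i, m)) * ?E i m \<Delta>)"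
    using X Y by (intro sum.cong refl)
      (simp add: scalar_prod_def Const_sum sum_distrib_right atLeast0LessThan)
  also have "(\<Sum>i<k. \<Sum>j<k. \<Sum>l<k. \<Sum>m<k. if m = i then Const (X $$ (i, j) * Y $$ (l, m)) * ?E l j \<Delta> else 0) =
    (\<Sum>i<k. \<Sum>j<k. \<Sum>l<k. Const (X $$ (i, j) * Y $$ (l, i)) * ?E l j \<Delta>)"
    by (intro sum.cong refl) (simp add: sum.delta)
  also have "\<dots> = (\<Sum>j<k. \<Sum>l<k. \<Sum>i<k. Const (X $$ (i, j) * Y $$ (l, i)) * ?E l j \<Delta>)"
    by (rule sum_swap3)
  also have "\<dots> = (\<Sum>l<k. \<Sum>j<k. \<Sum>i<k. Const (X $$ (i, j) * Y $$ (l, i)) * ?E l j \<Delta>)"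
    by (rule sum.swap)
  also have "\<dots> = (\<Sum>l<k. \<Sum>j<k. Const ((Y * X) $$ (l, j)) * ?E l j \<Delta>)"
    using X Y by (intro sum.cong refl)
      (simp add: scalar_prod_def Const_sum sum_distrib_left sum_distrib_right atLeast0LessThan mult.commute)
  also have "(\<Sum>i<k. \<Sum>m<k. Const ((X * Y) $$ (i, m)) * ?E i m \<Delta>) - \<dots> =
    (\<Sum>i<k. \<Sum>m<k. Const ((X * Y - Y * X) $$ (i, m)) * ?E i m \<Delta>)"
    using X Y by (simp add: Const_simps left_diff_distrib sum_subtractf)
  also have "\<dots> = tensor_act k d (gl_tensor (X * Y - Y * X)) \<Delta>"
    using X Y by (intro tensor_act_gl_tensor[symmetric]) auto
  finally show ?thesis by (simp add: tensor_act_diff)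
qed

lemma gl_tensor_carrier:
  assumes "X \<in> carrier_mat k k"
  shows "gl_tensor X \<in> carrier (tensor_alg k)"
proof -
  interpret ring "tensor_alg k" by (rule tensor_alg_ring)
  have sum: "sum f A \<in> carrier (tensor_alg k)" if "\<And>x. x \<in> A \<Longrightarrow> f x \<in> carrier (tensor_alg k)"
    for f :: "nat \<Rightarrow> tensor" and A
    using that
  proof (induction A rule: infinite_finite_induct)
    case (insert x A)
    then have "f x \<oplus>\<^bsub>tensor_alg k\<^esub> sum f A \<in> carrier (tensor_alg k)"
      by (intro a_closed) auto
    with insert show ?case by (simp add: tensor_alg_def)
  qed (auto simp: tensor_alg_def)
  show ?thesis
    unfolding gl_tensor_def using assms
    by (intro sum) (auto simp: tensor_alg_def)
qed

lemma tensor_act_uea_ideal: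
  assumes "t \<in> uea_ideal k"
  shows "tensor_act k d t \<Delta> = 0"
proof -
  interpret ring "tensor_alg k" by (rule tensor_alg_ring)
  let ?J = "{t \<in> carrier (tensor_alg k). \<forall>\<Delta>. tensor_act k d t \<Delta> = 0}"
  have neg: "\<ominus>\<^bsub>tensor_alg k\<^esub> t = - t" if "t \<in> carrier (tensor_alg k)" for t
  proof (rule minus_equality)
    have keys: "Poly_Mapping.keys (- t) = Poly_Mapping.keys t" by (auto simp: in_keys_iff)
    then show "- t \<in> carrier (tensor_alg k)" using that by (simp add: tensor_alg_def)
  qed (use that in \<open>simp_all add: tensor_alg_def\<close>)
  have minus: "- t \<in> carrier (tensor_alg k)" if "t \<in> carrier (tensor_alg k)" for t
    using a_inv_closed[OF that] neg[OF that] by simp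
  have plus: "s + t \<in> carrier (tensor_alg k)"
    if "s \<in> carrier (tensor_alg k)" "t \<in> carrier (tensor_alg k)" for s t
    using a_closed[OF that] by (simp add: tensor_alg_def)
  have times: "s * t \<in> carrier (tensor_alg k)"
    if "s \<in> carrier (tensor_alg k)" "t \<in> carrier (tensor_alg k)" for s t
    using m_closed[OF that] by (simp add: tensor_alg_def)
  have ops: "s \<oplus>\<^bsub>tensor_alg k\<^esub> t = s + t" "s \<otimes>\<^bsub>tensor_alg k\<^esub> t = s * t" "\<zero>\<^bsub>tensor_alg k\<^esub> = 0" for s t
    by (simp_all add: tensor_alg_def)
  have "ideal ?J (tensor_alg k)"
  proof (rule idealI[OF tensor_alg_ring])
    show "subgroup ?J (add_monoid (tensor_alg k))"
    proof (rule add.subgroupI)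
      show "?J \<noteq> {}" using zero_closed by (auto simp: ops intro!: exI[of _ 0])
    qed (use tensor_act_diff[of k d 0] in
        \<open>auto simp: ops neg minus plus tensor_act_add simp flip: a_inv_def\<close>)
  qed (auto simp: ops times tensor_act_mult)
  moreover have "{gl_tensor X * gl_tensor Y - gl_tensor Y * gl_tensor X - gl_tensor (X * Y - Y * X) | X Y.
      X \<in> carrier_mat k k \<and> Y \<in> carrier_mat k k} \<subseteq> ?J"
  proof clarify
    fix X Y :: "complex mat"
    assume XY: "X \<in> carrier_mat k k" "Y \<in> carrier_mat k k"
    then have "X * Y - Y * X \<in> carrier_mat k k" by auto
    with XY have "gl_tensor X * gl_tensor Y + - (gl_tensor Y * gl_tensor X) + - gl_tensor (X * Y - Y * X)
        \<in> carrier (tensor_alg k)"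
      by (intro plus minus times gl_tensor_carrier)
    with XY show "gl_tensor X * gl_tensor Y - gl_tensor Y * gl_tensor X - gl_tensor (X * Y - Y * X)
        \<in> carrier (tensor_alg k) \<and> (\<forall>\<Delta>. tensor_act k d
        (gl_tensor X * gl_tensor Y - gl_tensor Y * gl_tensor X - gl_tensor (X * Y - Y * X)) \<Delta> = 0)"
      by (simp add: tensor_act_relation)
  qed
  ultimately have "uea_ideal k \<subseteq> ?J"
    unfolding uea_ideal_def by (rule genideal_minimal)
  with assms show ?thesis by blast
qed

lemma uea_act_eq:
  assumes "P \<in> carrier (uea k)" "t \<in> P"
  shows "uea_act k d P \<Delta> = tensor_act k d t \<Delta>"
proof -
  obtain u where u: "P = uea_ideal k +>\<^bsub>tensor_alg k\<^esub> u"
    using assms(1) by (auto simp: uea_def FactRing_def A_RCOSETS_def')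
  have act: "tensor_act k d s \<Delta> = tensor_act k d u \<Delta>" if "s \<in> P" for s
    using that by (auto simp: u a_r_coset_def' tensor_alg_def tensor_act_add tensor_act_uea_ideal)
  have "(SOME t. t \<in> P) \<in> P" using assms(2) by (rule someI)
  with act assms(2) show ?thesis by (simp add: uea_act_def)
qed

end

theory Submission
  imports Defs
begin

text \<open>
  Normal ordering, i.e. the spanning half of the Poincare-Birkhoff-Witt theorem: modulo shorter words
  the letters of a word commute, so for \<open>n = k\<^sup>2\<close> an element of length \<open>L\<close> acts as a linear combination
  of the operators \<open>E\<^sub>1\<^bsup>a\<^sub>1\<^esup> \<dots> E\<^sub>n\<^bsup>a\<^sub>n\<^esup>\<close> with \<open>a\<^sub>1 + \<dots> + a\<^sub>n \<le> L\<close>.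
  By the Leibniz rule, such an operator applied to a product is a combination of products of operators
  with exponents \<open>b\<close> and \<open>c\<close>, where \<open>b + c = a\<close>. Hence all the normally ordered derivatives of every
  gate of a circuit can be computed from those of its children, at a cost per gate proportional to the
  number \<open>(2n + L choose 2n)\<close> of pairs \<open>(b, c)\<close>, which for \<open>L \<ge> 2\<close> is at most \<open>3/2 \<sqdot> L\<^bsup>2n\<^esup>\<close>.
\<close>

subsection \<open>Affine metapolynomials\<close>

lemma affine_metapolysI:
  "p = Const b + (\<Sum>\<mu>\<in>expos k d. Const (a \<mu>) * cvar \<mu>) \<Longrightarrow> p \<in> affine_metapolys k d"
  unfolding affine_metapolys_def mem_Collect_eq by (intro exI[of _ a] exI[of _ b] conjI TrueI)

lemma Const_mult_cvar_affine:
  assumes "\<mu> \<in> expos k d"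
  shows "Const x * cvar \<mu> \<in> affine_metapolys k d"
proof -
  have "Const x * cvar \<mu> =
      Const 0 + (\<Sum>\<nu>\<in>expos k d. Const (if \<nu> = \<mu> then x else 0) * cvar \<nu>)"
  proof -
    have "(\<Sum>\<nu>\<in>expos k d. Const (if \<nu> = \<mu> then x else 0) * cvar \<nu>) =
        (\<Sum>\<nu>\<in>expos k d. if \<nu> = \<mu> then Const x * cvar \<nu> else 0)"
      by (intro sum.cong) (auto simp: Const_simps)
    then show ?thesis using assms finite_expos by (simp add: sum.delta Const_simps)
  qed
  then show ?thesis by (rule affine_metapolysI)
qed

lemma zero_affine: "0 \<in> affine_metapolys k d"
proof -
  have "0 = Const 0 + (\<Sum>\<mu>\<in>expos k d. Const 0 * cvar \<mu>)" by (simp add: Const_simps)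
  then show ?thesis by (rule affine_metapolysI)
qed

lemma affine_add:
  assumes "p \<in> affine_metapolys k d" "q \<in> affine_metapolys k d"
  shows "p + q \<in> affine_metapolys k d"
proof -
  obtain a b a' b' where
    "p = Const b + (\<Sum>\<mu>\<in>expos k d. Const (a \<mu>) * cvar \<mu>)"
    "q = Const b' + (\<Sum>\<mu>\<in>expos k d. Const (a' \<mu>) * cvar \<mu>)"
    using assms unfolding affine_metapolys_def by blast
  then have "p + q = Const (b + b') + (\<Sum>\<mu>\<in>expos k d. Const (a \<mu> + a' \<mu>) * cvar \<mu>)"
    by (simp add: Const_simps algebra_simps sum.distrib)
  then show ?thesis by (rule affine_metapolysI)
qed

lemma affine_Const_mult:
  assumes "p \<in> affine_metapolys k d"
  shows "Const x * p \<in> affine_metapolys k d"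
proof -
  obtain a b where "p = Const b + (\<Sum>\<mu>\<in>expos k d. Const (a \<mu>) * cvar \<mu>)"
    using assms unfolding affine_metapolys_def by blast
  then have "Const x * p = Const (x * b) + (\<Sum>\<mu>\<in>expos k d. Const (x * a \<mu>) * cvar \<mu>)"
    by (simp add: Const_simps distrib_left sum_distrib_left mult.assoc)
  then show ?thesis by (rule affine_metapolysI)
qed

lemma affine_sum:
  assumes "\<And>x. x \<in> A \<Longrightarrow> f x \<in> affine_metapolys k d"
  shows "sum f A \<in> affine_metapolys k d"
  using assms by (induction A rule: infinite_finite_induct) (auto simp: zero_affine affine_add)

text \<open>Input gates stay input gates: the derivation kills the constant term and sends each
  variable to a multiple of a variable or to \<open>0\<close>. The assumption \<open>i < k\<close>
  keeps the shifted exponent vector in \<open>expos k d\<close>.\<close>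

lemma E_act_affine:
  assumes p: "p \<in> affine_metapolys k d" and "i < k"
  shows "E_act k d i j p \<in> affine_metapolys k d"
proof -
  have cvar: "E_act k d i j (cvar \<mu>) \<in> affine_metapolys k d" if "\<mu> \<in> expos k d" for \<mu>
  proof (cases "Poly_Mapping.lookup \<mu> j = 0")
    case True
    then show ?thesis by (simp add: E_act_cvar_eq_0 zero_affine)
  next
    case False
    then obtain \<rho> where \<rho>: "\<mu> = \<rho> + Poly_Mapping.single j 1" by (rule poly_mapping_split_single)
    with that \<open>i < k\<close> have "\<rho> + Poly_Mapping.single i 1 \<in> expos k d" using expos_shift by blast
    with that \<rho> show ?thesis
      by (simp add: E_act_cvar_add Const_mult_cvar_affine del: One_nat_def)
  qed
  obtain a b where "p = Const b + (\<Sum>\<mu>\<in>expos k d. Const (a \<mu>) * cvar \<mu>)"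
    using p unfolding affine_metapolys_def by blast
  then have "E_act k d i j p = (\<Sum>\<mu>\<in>expos k d. Const (a \<mu>) * E_act k d i j (cvar \<mu>))"
    by (simp add: E_act_add E_act_sum E_act_Const_mult)
  then show ?thesis using cvar by (auto intro!: affine_sum affine_Const_mult)
qed


subsection \<open>Straight-line programs\<close>

text \<open>The values that a single \<open>Plus\<close> or \<open>Times\<close> gate can take on
  children with values in \<open>S\<close>; \<open>a\<close> and \<open>b\<close> are the edge
  labels.\<close>

definition derived :: "metapoly set \<Rightarrow> metapoly set" where
  "derived S = {Const a * p + Const b * q | a b p q. p \<in> S \<and> q \<in> S} \<union>
    {(Const a * p) * (Const b * q) | a b p q. p \<in> S \<and> q \<in> S}"

text \<open>A list of intermediate results, the most recent one first.\<close>

inductive slp :: "nat \<Rightarrow> nat \<Rightarrow> metapoly list \<Rightarrow> bool" for k d where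
  Nil: "slp k d []"
| Cons: "slp k d ps \<Longrightarrow> p \<in> affine_metapolys k d \<union> derived (set ps) \<Longrightarrow> slp k d (p # ps)"

lemma derived_mono: "S \<subseteq> T \<Longrightarrow> derived S \<subseteq> derived T"
  unfolding derived_def by blast

lemma derived_lin: "p \<in> S \<Longrightarrow> q \<in> S \<Longrightarrow> Const a * p + Const b * q \<in> derived S"
  unfolding derived_def by blast

lemma derived_prod: "p \<in> S \<Longrightarrow> q \<in> S \<Longrightarrow> Const a * p * (Const b * q) \<in> derived S"
  unfolding derived_def by blast

lemma derived_add: "p \<in> S \<Longrightarrow> q \<in> S \<Longrightarrow> p + q \<in> derived S"
  using derived_lin[of p S q 1 1] by (simp add: Const_simps)

lemma derived_Const_mult: "p \<in> S \<Longrightarrow> Const a * p \<in> derived S"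
  using derived_lin[of p S p a 0] by (simp add: Const_simps)

lemma derived_Const_mult_prod: "p \<in> S \<Longrightarrow> q \<in> S \<Longrightarrow> Const a * (p * q) \<in> derived S"
  using derived_prod[of p S q a 1] by (simp add: Const_simps mult.assoc)

lemma slp_suffix: "slp k d (xs @ ys) \<Longrightarrow> slp k d ys"
  by (induction xs) (auto elim: slp.cases)

lemma slp_extend:
  assumes "finite X" "slp k d ps" "X \<subseteq> affine_metapolys k d \<union> derived (set ps)"
  shows "\<exists>ps'. slp k d ps' \<and> set ps \<union> X \<subseteq> set ps' \<and> length ps' \<le> length ps + card X"
  using assms
proof (induction X rule: finite_induct)
  case (insert x X)
  then obtain ps' where ps': "slp k d ps'" "set ps \<union> X \<subseteq> set ps'" "length ps' \<le> length ps + card X"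
    by auto
  then have "x \<in> affine_metapolys k d \<union> derived (set ps')"
    using insert.prems derived_mono[of "set ps" "set ps'"] by blast
  with ps' insert.hyps show ?case
    by (intro exI[of _ "x # ps'"]) (auto intro: slp.Cons)
qed auto

text \<open>Every summand costs two entries, itself and the next partial sum; the additional entry
  is the initial \<open>0\<close>.\<close>

lemma slp_extend_sum:
  assumes "finite I" "slp k d ps" "f ` I \<subseteq> derived (set ps)"
  shows "\<exists>ps'. slp k d ps' \<and> insert (sum f I) (set ps) \<subseteq> set ps' \<and>
    length ps' \<le> length ps + 2 * card I + 1"
  using assms
proof (induction I rule: finite_induct)
  case empty
  then show ?case by (intro exI[of _ "0 # ps"]) (auto intro: slp.Cons zero_affine)
next
  case (insert i I)
  then obtain ps' where ps': "slp k d ps'" "insert (sum f I) (set ps) \<subseteq> set ps'"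
    "length ps' \<le> length ps + 2 * card I + 1"
    by auto
  then have "f i \<in> derived (set ps')"
    using insert.prems derived_mono[of "set ps" "set ps'"] by blast
  with ps'(1) have "slp k d (f i # ps')" by (auto intro: slp.Cons)
  moreover have "f i + sum f I \<in> derived (set (f i # ps'))"
    using ps'(2) by (intro derived_add) auto
  ultimately have "slp k d ((f i + sum f I) # f i # ps')" by (auto intro: slp.Cons)
  with ps' insert.hyps show ?case
    by (intro exI[of _ "(f i + sum f I) # f i # ps'"]) auto
qed

lemma slp_extend_sums:
  assumes "finite A" "slp k d ps" "\<And>a. a \<in> A \<Longrightarrow> finite (S a)"
    "\<And>a. a \<in> A \<Longrightarrow> f a ` S a \<subseteq> derived (set ps)"
  shows "\<exists>ps'. slp k d ps' \<and> set ps \<union> (\<lambda>a. sum (f a) (S a)) ` A \<subseteq> set ps' \<and>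
    length ps' \<le> length ps + (card A + 2 * (\<Sum>a\<in>A. card (S a)))"
  using assms
proof (induction A rule: finite_induct)
  case (insert a A)
  then obtain ps' where ps': "slp k d ps'" "set ps \<union> (\<lambda>a. sum (f a) (S a)) ` A \<subseteq> set ps'"
    "length ps' \<le> length ps + (card A + 2 * (\<Sum>a\<in>A. card (S a)))"
    by auto
  have "f a ` S a \<subseteq> derived (set ps')"
    using insert.prems(3)[of a] derived_mono[of "set ps" "set ps'"] ps'(2) by blast
  with slp_extend_sum[OF _ ps'(1), of "S a" "f a"] insert.prems(2)
  obtain ps'' where "slp k d ps''" "insert (sum (f a) (S a)) (set ps') \<subseteq> set ps''"
    "length ps'' \<le> length ps' + 2 * card (S a) + 1"
    by auto
  with ps' insert.hyps show ?case by (intro exI[of _ ps'']) auto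
qed auto


subsection \<open>Circuits and straight-line programs\<close>

lemma slp_nth:
  assumes "slp k d ps" "i < length ps"
  shows "rev ps ! i \<in> affine_metapolys k d \<union> derived (set (take i (rev ps)))"
  using assms by (induction rule: slp.induct) (auto simp: nth_append less_Suc_eq)

text \<open>Position \<open>v\<close> of the chronological list \<open>rev (\<Delta> # ps)\<close>
  becomes vertex \<open>v\<close>. Operands sit at smaller positions, so the graph is
  acyclic.\<close>

lemma slp_Cons_imp_circuit:
  assumes "slp k d (\<Delta> # ps)"
  shows "\<exists>C. is_circuit k d C \<and> computes C \<Delta> \<and> circuit_size C \<le> Suc (length ps)"
proof -
  define n where "n = length ps"
  define val where "val i = rev (\<Delta> # ps) ! i" for i
  have val_n: "val n = \<Delta>" by (simp add: val_def n_def nth_append)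
  \<comment> \<open>\<open>g\<close> is a gate label for position \<open>i\<close>;
    \<open>t b\<close> and \<open>c b\<close> are the source and the scalar of its operand number
    \<open>b\<close>, which is \<open>0\<close> or \<open>1\<close>.\<close>
  define ok where "ok i g t c \<longleftrightarrow> (case g of
      Input A \<Rightarrow> A \<in> affine_metapolys k d \<and> val i = A
    | Plus \<Rightarrow> t 0 < i \<and> t 1 < i \<and> val i = Const (c 0) * val (t 0) + Const (c 1) * val (t 1)
    | Times \<Rightarrow> t 0 < i \<and> t 1 < i \<and> val i = Const (c 0) * val (t 0) * (Const (c 1) * val (t 1)))"
    for i g and t :: "nat \<Rightarrow> nat" and c :: "nat \<Rightarrow> complex"
  have "\<exists>g t c. i \<le> n \<longrightarrow> ok i g t c" for i
  proof (cases "i \<le> n")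
    case True
    have take: "\<exists>j<i. p = val j" if "p \<in> set (take i (rev (\<Delta> # ps)))" for p
      using that by (auto simp: val_def in_set_conv_nth simp del: rev.simps)
    have "val i \<in> affine_metapolys k d \<union> derived (set (take i (rev (\<Delta> # ps))))"
      unfolding val_def by (rule slp_nth[OF assms]) (use True in \<open>simp add: n_def\<close>)
    then consider "val i \<in> affine_metapolys k d"
      | a b p q where "p \<in> set (take i (rev (\<Delta> # ps)))" "q \<in> set (take i (rev (\<Delta> # ps)))"
        "val i = Const a * p + Const b * q"
      | a b p q where "p \<in> set (take i (rev (\<Delta> # ps)))" "q \<in> set (take i (rev (\<Delta> # ps)))"
        "val i = Const a * p * (Const b * q)"
      unfolding derived_def by blast
    then show ?thesis
    proof cases
      case 1
      then show ?thesis by (auto simp: ok_def intro!: exI[of _ "Input (val i)"])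
    next
      case (2 a b p q)
      then obtain j l where "j < i" "p = val j" "l < i" "q = val l" using take by blast
      with 2 have "ok i Plus (\<lambda>x. if x = 0 then j else l) (\<lambda>x. if x = 0 then a else b)"
        by (simp add: ok_def)
      then show ?thesis by blast
    next
      case (3 a b p q)
      then obtain j l where "j < i" "p = val j" "l < i" "q = val l" using take by blast
      with 3 have "ok i Times (\<lambda>x. if x = 0 then j else l) (\<lambda>x. if x = 0 then a else b)"
        by (simp add: ok_def)
      then show ?thesis by blast
    qed
  qed auto
  then obtain G T c where ok: "\<And>i. i \<le> n \<Longrightarrow> ok i (G i) (T i) (c i)" by metis
  define inner where "inner v \<longleftrightarrow> G v = Plus \<or> G v = Times" for v
  define R where "R = {(T v b, v) | v b. v \<le> n \<and> inner v \<and> b < (2::nat)}"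
  \<comment> \<open>Only the vertices leading to the output are kept, so that it is the unique sink.\<close>
  define V where "V = {v. (v, n) \<in> R\<^sup>*}"
  have T_less: "T v b < v" if "v \<le> n" "inner v" "b < 2" for v b
    using ok[OF that(1)] that by (auto simp: ok_def inner_def less_2_cases_iff)
  have V_le: "v \<le> n" if "v \<in> V" for v
    using that unfolding V_def mem_Collect_eq
    by (induction rule: converse_rtrancl_induct) (use T_less in \<open>force simp: R_def\<close>)+
  have V_T: "T v b \<in> V" if "v \<in> V" "inner v" "b < 2" for v b
    using that V_le[OF that(1)] unfolding V_def
    by (auto simp: R_def intro: converse_rtrancl_into_rtrancl)
  have n_V: "n \<in> V" by (simp add: V_def)
  \<comment> \<open>Arc \<open>2 * v + b\<close> is operand \<open>b\<close> of vertex
    \<open>v\<close>, so the two inputs of a gate are distinct arcs even when they come from the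
    same vertex.\<close>
  define H where "H = \<lparr>verts = V, arcs = {e. e div 2 \<in> V \<and> inner (e div 2)},
    tail = \<lambda>e. T (e div 2) (e mod 2), head = \<lambda>e. e div 2\<rparr>"
  define C where "C = \<lparr>dag = H, gate = G, scalar = \<lambda>e. c (e div 2) (e mod 2)\<rparr>"
  have sel [simp]: "dag C = H" "gate C = G" "scalar C = (\<lambda>e. c (e div 2) (e mod 2))"
    "verts H = V" "arcs H = {e. e div 2 \<in> V \<and> inner (e div 2)}"
    "tail H = (\<lambda>e. T (e div 2) (e mod 2))" "head H = (\<lambda>e. e div 2)"
    by (simp_all add: C_def H_def)
  have fin_V: "finite V" using V_le by (meson finite_nat_set_iff_bounded_le)
  have fin: "fin_digraph H"
  proof
    show "finite (arcs H)"
    proof (rule finite_subset)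
      show "arcs H \<subseteq> {..2 * n + 1}" using V_le by force
    qed simp
  qed (auto simp: V_T fin_V)
  have acyc: "acyclic (arcs_ends H)"
  proof (rule acyclic_subset)
    show "arcs_ends H \<subseteq> less_than" by (auto simp: arcs_ends_conv intro!: T_less V_le)
  qed (simp add: wf_acyclic)
  have in_arcs: "in_arcs H v = (if inner v then {2 * v, 2 * v + 1} else {})" if "v \<in> V" for v
  proof -
    have "e div 2 = v \<longleftrightarrow> e = 2 * v \<or> e = 2 * v + 1" for e :: nat by presburger
    then show ?thesis using that by (auto simp: in_arcs_def)
  qed
  have fin_out: "finite (out_arcs H v)" for v
    using fin by (rule fin_digraph.finite_out_arcs)
  \<comment> \<open>A kept vertex other than \<open>n\<close> has a first step on its path to
    \<open>n\<close>, hence an outgoing arc. Vertex \<open>n\<close> has none, because arcs increase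
    the index and \<open>n\<close> is the largest one.\<close>
  have out: "out_degree H v = 0 \<longleftrightarrow> v = n" if "v \<in> V" for v
  proof
    assume 0: "out_degree H v = 0"
    show "v = n"
    proof (rule ccontr)
      assume "v \<noteq> n"
      with that obtain w where w: "(v, w) \<in> R" "(w, n) \<in> R\<^sup>*"
        by (auto simp: V_def elim: converse_rtranclE)
      then obtain b where b: "v = T w b" "inner w" "b < 2" by (auto simp: R_def)
      with w have "2 * w + b \<in> out_arcs H v" by (auto simp: out_arcs_def V_def)
      with 0 fin_out show False by (auto simp: out_degree_def)
    qed
  next
    assume "v = n"
    have "T (e div 2) (e mod 2) \<noteq> n" if "e div 2 \<in> V" "inner (e div 2)" for e
      using T_less[of "e div 2" "e mod 2"] V_le[of "e div 2"] that by simp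
    with \<open>v = n\<close> have "out_arcs H v = {}" by (auto simp: out_arcs_def)
    then show "out_degree H v = 0" by (simp add: out_degree_def)
  qed
  have "is_circuit k d C"
    unfolding is_circuit_def
  proof (intro conjI ballI)
    show "\<exists>!v. v \<in> verts (dag C) \<and> out_degree (dag C) v = 0"
      using n_V out by auto
    fix v assume "v \<in> verts (dag C)"
    then show "case gate C v of
          Input A \<Rightarrow> in_degree (dag C) v = 0 \<and> A \<in> affine_metapolys k d
        | Plus \<Rightarrow> in_degree (dag C) v = 2
        | Times \<Rightarrow> in_degree (dag C) v = 2"
      using ok[of v] V_le[of v]
      by (auto simp: in_degree_def in_arcs inner_def ok_def split: gate_label.splits)
  qed (use fin acyc in auto)
  moreover have "gate_values C val"
    unfolding gate_values_def
  proof
    fix v assume "v \<in> verts (dag C)"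
    then show "val v = (case gate C v of
          Input A \<Rightarrow> A
        | Plus \<Rightarrow> (\<Sum>e\<in>in_arcs (dag C) v. Const (scalar C e) * val (tail (dag C) e))
        | Times \<Rightarrow> (\<Prod>e\<in>in_arcs (dag C) v. Const (scalar C e) * val (tail (dag C) e)))"
      using ok[of v] V_le[of v]
      by (auto simp: in_arcs inner_def ok_def split: gate_label.splits)
  qed
  then have "computes C \<Delta>"
    using n_V out val_n by (auto simp: computes_def)
  moreover have "circuit_size C \<le> Suc (length ps)"
  proof -
    have "card V \<le> card {..n}" using V_le by (intro card_mono) auto
    then show ?thesis by (simp add: circuit_size_def n_def)
  qed
  ultimately show ?thesis by blast
qed

text \<open>Entries more recent than an occurrence of \<Delta> are discarded, so that \<Delta>
  becomes the output.\<close>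

lemma slp_imp_circuit:
  assumes "slp k d ps" "\<Delta> \<in> set ps"
  shows "\<exists>C. is_circuit k d C \<and> computes C \<Delta> \<and> circuit_size C \<le> length ps"
proof -
  obtain xs ys where ps: "ps = xs @ \<Delta> # ys" using assms(2) by (meson split_list)
  with assms(1) have "slp k d (\<Delta> # ys)" by (auto dest: slp_suffix)
  from slp_Cons_imp_circuit[OF this] obtain C where
    "is_circuit k d C" "computes C \<Delta>" "circuit_size C \<le> Suc (length ys)" by blast
  with ps show ?thesis by (intro exI[of _ C]) auto
qed

text \<open>The gates are evaluated in a topological order, with one entry per vertex.\<close>

lemma circuit_imp_slp:
  assumes C: "is_circuit k d C" and "computes C \<Delta>"
  shows "\<exists>ps. slp k d ps \<and> \<Delta> \<in> set ps \<and> length ps = circuit_size C"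
proof -
  define H where "H = dag C"
  interpret H: fin_digraph H using C by (simp add: is_circuit_def H_def)
  obtain val v where val: "gate_values C val" and v: "v \<in> verts H" "val v = \<Delta>"
    using assms(2) by (auto simp: computes_def H_def)
  have "finite (arcs_ends H)" by (simp add: arcs_ends_conv)
  then have wf: "wf (arcs_ends H)"
    using C by (simp add: finite_acyclic_wf is_circuit_def H_def)
  \<comment> \<open>\<open>U\<close> consists of \<open>m\<close> vertices already evaluated and is
    closed under predecessors. A minimal vertex of its complement has all its predecessors in
    \<open>U\<close>, so it can be evaluated next.\<close>
  have "\<exists>U ps. U \<subseteq> verts H \<and> card U = m \<and> (\<forall>e\<in>arcs H. head H e \<in> U \<longrightarrow> tail H e \<in> U) \<and>
      slp k d ps \<and> val ` U \<subseteq> set ps \<and> length ps = m" if "m \<le> card (verts H)" for m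
    using that
  proof (induction m)
    case 0
    then show ?case by (intro exI[of _ "{}"] exI[of _ "[]"]) (auto intro: slp.Nil)
  next
    case (Suc m)
    then obtain U ps where U: "U \<subseteq> verts H" "card U = m"
      "\<And>e. e \<in> arcs H \<Longrightarrow> head H e \<in> U \<Longrightarrow> tail H e \<in> U"
      and ps: "slp k d ps" "val ` U \<subseteq> set ps" "length ps = m" by (auto simp: Suc_le_eq)
    have "verts H - U \<noteq> {}" using U(1,2) Suc.prems by auto
    with wf obtain w where w: "w \<in> verts H - U" and
      min: "\<And>u. (u, w) \<in> arcs_ends H \<Longrightarrow> u \<notin> verts H - U"
      by (meson ex_in_conv wfE_min)
    have tails: "tail H e \<in> U" if "e \<in> in_arcs H w" for e
    proof -
      from that have "e \<in> arcs H" "(tail H e, w) \<in> arcs_ends H"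
        by (auto simp: in_arcs_def arcs_ends_conv)
      with min H.tail_in_verts show ?thesis by blast
    qed
    have gate: "case gate C w of
          Input A \<Rightarrow> in_degree H w = 0 \<and> A \<in> affine_metapolys k d
        | Plus \<Rightarrow> in_degree H w = 2
        | Times \<Rightarrow> in_degree H w = 2"
      using C w unfolding is_circuit_def H_def by blast
    have val_w: "val w = (case gate C w of
          Input A \<Rightarrow> A
        | Plus \<Rightarrow> (\<Sum>e\<in>in_arcs H w. Const (scalar C e) * val (tail H e))
        | Times \<Rightarrow> (\<Prod>e\<in>in_arcs H w. Const (scalar C e) * val (tail H e)))"
      using val w unfolding gate_values_def H_def by blast
    have two: "\<exists>e f. in_arcs H w = {e, f} \<and> e \<noteq> f \<and> val (tail H e) \<in> set ps \<and> val (tail H f) \<in> set ps"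
      if "in_degree H w = 2"
    proof -
      from that obtain e f where "in_arcs H w = {e, f}" "e \<noteq> f"
        by (auto simp: in_degree_def card_2_iff)
      with tails[of e] tails[of f] ps(2) show ?thesis by blast
    qed
    have "val w \<in> affine_metapolys k d \<union> derived (set ps)"
    proof (cases "gate C w")
      case (Input A)
      then show ?thesis using gate val_w by auto
    next
      case Plus
      with gate two obtain e f where "in_arcs H w = {e, f}" "e \<noteq> f"
        "val (tail H e) \<in> set ps" "val (tail H f) \<in> set ps" by auto
      with Plus val_w show ?thesis by (auto intro: derived_lin)
    next
      case Times
      with gate two obtain e f where "in_arcs H w = {e, f}" "e \<noteq> f"
        "val (tail H e) \<in> set ps" "val (tail H f) \<in> set ps" by auto
      with Times val_w show ?thesis by (auto intro: derived_prod)
    qed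
    with ps have "slp k d (val w # ps)" by (auto intro: slp.Cons)
    moreover have "tail H e \<in> insert w U" if "e \<in> arcs H" "head H e \<in> insert w U" for e
      using that U(3) tails by (auto simp: in_arcs_def)
    moreover have "card (insert w U) = Suc m"
      using w U finite_subset[OF U(1)] by auto
    ultimately show ?case using w U(1) ps
      by (intro exI[of _ "insert w U"] exI[of _ "val w # ps"]) auto
  qed
  from this[of "card (verts H)"] obtain U ps where "U \<subseteq> verts H" "card U = card (verts H)"
    "slp k d ps" "val ` U \<subseteq> set ps" "length ps = card (verts H)" by auto
  moreover from this have "U = verts H" by (simp add: card_subset_eq)
  ultimately show ?thesis using v by (auto simp: circuit_size_def H_def)
qed


subsection \<open>Families of operators with a product rule\<close>

text \<open>\<open>S\<close> and \<open>\<kappa>\<close> describe a coproduct. As the components of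
  all pairs in \<open>S a\<close> lie in \<open>A\<close>, the values \<open>D a q\<close> of a gate
  need only the stored values of its children. For each \<open>a\<close>, a product gate costs one
  initial \<open>0\<close> and two entries per pair in \<open>S a\<close>, which explains the length
  factor.\<close>

lemma slp_apply_operators:
  fixes D :: "'a \<Rightarrow> metapoly \<Rightarrow> metapoly"
  assumes A: "finite A" "\<And>a. a \<in> A \<Longrightarrow> finite (S a)" "\<And>a. a \<in> A \<Longrightarrow> S a \<subseteq> A \<times> A"
    and add: "\<And>a p q. a \<in> A \<Longrightarrow> D a (p + q) = D a p + D a q"
    and scal: "\<And>a x p. a \<in> A \<Longrightarrow> D a (Const x * p) = Const x * D a p"
    and mult: "\<And>a p q. a \<in> A \<Longrightarrow>
      D a (p * q) = (\<Sum>(b, c)\<in>S a. Const (\<kappa> b c) * (D b p * D c q))"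
    and aff: "\<And>a p. a \<in> A \<Longrightarrow> p \<in> affine_metapolys k d \<Longrightarrow> D a p \<in> affine_metapolys k d"
    and qs: "slp k d qs"
  shows "\<exists>ps. slp k d ps \<and> (\<forall>q\<in>set qs. \<forall>a\<in>A. D a q \<in> set ps) \<and>
    length ps \<le> length qs * (card A + 2 * (\<Sum>a\<in>A. card (S a)))"
  using qs
proof (induction rule: slp.induct)
  case Nil
  then show ?case by (auto intro: slp.Nil)
next
  case (Cons qs q)
  let ?M = "card A + 2 * (\<Sum>a\<in>A. card (S a))"
  obtain ps where ps: "slp k d ps" "\<And>q a. q \<in> set qs \<Longrightarrow> a \<in> A \<Longrightarrow> D a q \<in> set ps"
    "length ps \<le> length qs * ?M"
    using Cons.IH by blast
  have "\<exists>ps'. slp k d ps' \<and> set ps \<union> (\<lambda>a. D a q) ` A \<subseteq> set ps' \<and> length ps' \<le> length ps + ?M"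
  \<comment> \<open>The first case covers affine \<open>q\<close> and linear combinations
    \<open>q\<close> together, at one entry per operator. Outside of it \<open>q\<close> must be a
    product.\<close>
  proof (cases "(\<lambda>a. D a q) ` A \<subseteq> affine_metapolys k d \<union> derived (set ps)")
    case True
    from slp_extend[OF _ ps(1) this] A(1) obtain ps' where
      "slp k d ps'" "set ps \<union> (\<lambda>a. D a q) ` A \<subseteq> set ps'"
      "length ps' \<le> length ps + card ((\<lambda>a. D a q) ` A)" by auto
    moreover have "card ((\<lambda>a. D a q) ` A) \<le> card A" using A(1) by (rule card_image_le)
    ultimately show ?thesis by (intro exI[of _ ps']) auto
  next
    case False
    then have "q \<notin> affine_metapolys k d" using aff by auto
    with Cons.hyps have "q \<in> derived (set qs)" by simp
    moreover have "q \<noteq> Const x * p + Const y * r" if "p \<in> set qs" "r \<in> set qs" for x y p r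
    proof
      assume "q = Const x * p + Const y * r"
      then have "(\<lambda>a. D a q) ` A \<subseteq> derived (set ps)"
        using ps(2) that by (auto simp: add scal intro!: derived_lin)
      with False show False by blast
    qed
    ultimately obtain x y p r where pr: "p \<in> set qs" "r \<in> set qs"
      and q: "q = Const x * p * (Const y * r)"
      unfolding derived_def by blast
    \<comment> \<open>The edge scalars \<open>x\<close> and \<open>y\<close> are absorbed into the
      coefficient, so each summand is a single \<open>Times\<close> gate on stored values.\<close>
    define f where "f = (\<lambda>(b, c). Const (\<kappa> b c * x * y) * (D b p * D c r))"
    have "D a q = sum f (S a)" if "a \<in> A" for a
      unfolding q mult[OF that] f_def
    proof (intro sum.cong refl, clarify)
      fix b c assume "(b, c) \<in> S a"
      with A(3)[OF that] have "b \<in> A" "c \<in> A" by auto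
      then have "D b (Const x * p) * D c (Const y * r) = Const x * D b p * (Const y * D c r)"
        by (simp only: scal)
      then show "Const (\<kappa> b c) * (D b (Const x * p) * D c (Const y * r)) =
          Const (\<kappa> b c * x * y) * (D b p * D c r)"
        by (simp add: Const_simps ac_simps)
    qed
    then have eq: "(\<lambda>a. D a q) ` A = (\<lambda>a. sum f (S a)) ` A" by simp
    have "f ` S a \<subseteq> derived (set ps)" if "a \<in> A" for a
      using A(3)[OF that] pr ps(2) by (auto simp: f_def intro!: derived_Const_mult_prod)
    then show ?thesis unfolding eq using A ps(1) by (intro slp_extend_sums) auto
  qed
  then obtain ps' where "slp k d ps'" "set ps \<union> (\<lambda>a. D a q) ` A \<subseteq> set ps'"
    "length ps' \<le> length ps + ?M" by blast
  with ps show ?case by (intro exI[of _ ps']) auto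
qed

text \<open>Let \<open>T\<close> be the sum of all \<open>card (S a)\<close> and \<open>s\<close>
  the size of \<open>C\<close>. Nonemptiness of the \<open>S a\<close> gives
  \<open>card A \<le> T\<close>, so the program for all the \<open>D a q\<close> has length at most
  \<open>3 * s * T\<close>. The final linear combination adds \<open>2 * card A + 1\<close>, again
  at most \<open>3 * s * T\<close>.\<close>

lemma circuit_apply_operators:
  fixes D :: "'a \<Rightarrow> metapoly \<Rightarrow> metapoly"
  assumes A: "finite A" "A \<noteq> {}" "\<And>a. a \<in> A \<Longrightarrow> finite (S a)" "\<And>a. a \<in> A \<Longrightarrow> S a \<noteq> {}"
      "\<And>a. a \<in> A \<Longrightarrow> S a \<subseteq> A \<times> A"
    and add: "\<And>a p q. a \<in> A \<Longrightarrow> D a (p + q) = D a p + D a q"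
    and scal: "\<And>a x p. a \<in> A \<Longrightarrow> D a (Const x * p) = Const x * D a p"
    and mult: "\<And>a p q. a \<in> A \<Longrightarrow>
      D a (p * q) = (\<Sum>(b, c)\<in>S a. Const (\<kappa> b c) * (D b p * D c q))"
    and aff: "\<And>a p. a \<in> A \<Longrightarrow> p \<in> affine_metapolys k d \<Longrightarrow> D a p \<in> affine_metapolys k d"
    and C: "is_circuit k d C" "computes C \<Delta>"
  shows "\<exists>C'. is_circuit k d C' \<and> computes C' (\<Sum>a\<in>A. Const (x a) * D a \<Delta>) \<and>
    circuit_size C' \<le> 6 * circuit_size C * (\<Sum>a\<in>A. card (S a))"
proof -
  let ?s = "circuit_size C" and ?T = "\<Sum>a\<in>A. card (S a)"
  obtain qs where qs: "slp k d qs" "\<Delta> \<in> set qs" "length qs = ?s"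
    using circuit_imp_slp[OF C] by blast
  obtain ps where ps: "slp k d ps" "\<And>q a. q \<in> set qs \<Longrightarrow> a \<in> A \<Longrightarrow> D a q \<in> set ps"
    "length ps \<le> ?s * (card A + 2 * ?T)"
    using slp_apply_operators[OF A(1,3,5) add scal mult aff qs(1)] unfolding qs(3) by blast
  have "(\<lambda>a. Const (x a) * D a \<Delta>) ` A \<subseteq> derived (set ps)"
    using ps(2) qs(2) by (auto intro: derived_Const_mult)
  from slp_extend_sum[OF A(1) ps(1) this] obtain ps' where
    ps': "slp k d ps'" "(\<Sum>a\<in>A. Const (x a) * D a \<Delta>) \<in> set ps'"
    "length ps' \<le> length ps + 2 * card A + 1" by auto
  have AT: "card A \<le> ?T"
  proof -
    have "(\<Sum>a\<in>A. 1) \<le> ?T" using A by (intro sum_mono) (simp add: Suc_le_eq card_gt_0_iff)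
    then show ?thesis by simp
  qed
  have "1 \<le> card A" using A(1,2) by (simp add: Suc_le_eq card_gt_0_iff)
  moreover have "1 \<le> ?s" using qs(2,3) by (cases qs) auto
  then have "?T \<le> ?s * ?T" by simp
  moreover have "?s * (card A + 2 * ?T) \<le> ?s * (3 * ?T)" using AT by (intro mult_left_mono) auto
  ultimately have "length ps' \<le> 6 * ?s * ?T"
    using ps(3) ps'(3) AT by linarith
  then show ?thesis using slp_imp_circuit[OF ps'(1,2)] le_trans by blast
qed


subsection \<open>Normally ordered products\<close>

text \<open>A Poincare-Birkhoff-Witt monomial: the letters come in the order of \<open>es\<close>
  with exponents \<open>as\<close>, and the last letter acts first.\<close>

definition pbw :: "nat \<Rightarrow> nat \<Rightarrow> (nat \<times> nat) list \<Rightarrow> nat list \<Rightarrow> metapoly \<Rightarrow> metapoly" where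
  "pbw k d es as = foldr (\<lambda>((i, j), a). E_act k d i j ^^ a) (zip es as)"

lemma pbw_simps [simp]:
  "pbw k d [] as p = p"
  "pbw k d ((i, j) # es) (a # as) p = (E_act k d i j ^^ a) (pbw k d es as p)"
  by (simp_all add: pbw_def)

lemma funpow_E_act_add:
  "(E_act k d i j ^^ a) (p + q) = (E_act k d i j ^^ a) p + (E_act k d i j ^^ a) q"
  by (induction a) (auto simp: E_act_add)

lemma funpow_E_act_Const_mult:
  "(E_act k d i j ^^ a) (Const x * p) = Const x * (E_act k d i j ^^ a) p"
  by (induction a) (auto simp: E_act_Const_mult)

lemma funpow_E_act_diff:
  "(E_act k d i j ^^ a) (p - q) = (E_act k d i j ^^ a) p - (E_act k d i j ^^ a) q"
  using funpow_E_act_add[of a k d i j "p - q" q] by (simp add: algebra_simps)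

lemma funpow_E_act_sum:
  "(E_act k d i j ^^ a) (sum f A) = (\<Sum>x\<in>A. (E_act k d i j ^^ a) (f x))"
  by (induction a) (auto simp: E_act_sum)

lemma pbw_add:
  "length as = length es \<Longrightarrow> pbw k d es as (p + q) = pbw k d es as p + pbw k d es as q"
  by (induction as es rule: list_induct2) (auto simp: funpow_E_act_add)

lemma pbw_Const_mult:
  "length as = length es \<Longrightarrow> pbw k d es as (Const x * p) = Const x * pbw k d es as p"
  by (induction as es rule: list_induct2) (auto simp: funpow_E_act_Const_mult)

lemma funpow_E_act_affine:
  assumes "i < k" "p \<in> affine_metapolys k d"
  shows "(E_act k d i j ^^ a) p \<in> affine_metapolys k d"
  using assms by (induction a) (auto intro: E_act_affine)

lemma pbw_affine:
  assumes "length as = length es" "set es \<subseteq> {..<k} \<times> {..<k}" "p \<in> affine_metapolys k d"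
  shows "pbw k d es as p \<in> affine_metapolys k d"
  using assms by (induction as es rule: list_induct2) (auto intro!: funpow_E_act_affine)

lemma pbw_replicate_0: "pbw k d es (replicate (length es) 0) p = p"
  by (induction es) auto

text \<open>The general Leibniz rule, proved like the binomial theorem from Pascal's
  identity.\<close>

lemma funpow_E_act_mult:
  "(E_act k d i j ^^ a) (p * q) =
    (\<Sum>l\<le>a. Const (of_nat (a choose l)) * ((E_act k d i j ^^ l) p * (E_act k d i j ^^ (a - l)) q))"
proof (induction a)
  case 0
  then show ?case by (simp add: Const_simps)
next
  case (Suc a)
  let ?E = "E_act k d i j"
  let ?u = "\<lambda>l. (?E ^^ l) p" and ?v = "\<lambda>l. (?E ^^ l) q" and ?C = "\<lambda>n l. Const (of_nat (n choose l))"
  have "(?E ^^ Suc a) (p * q) = (\<Sum>l\<le>a. ?C a l * (?u (Suc l) * ?v (a - l))) +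
      (\<Sum>l\<le>a. ?C a l * (?u l * ?v (Suc a - l)))"
    by (simp add: Suc E_act_sum E_act_Const_mult E_act_mult distrib_left sum.distrib Suc_diff_le)
  also have "(\<Sum>l\<le>a. ?C a l * (?u l * ?v (Suc a - l))) =
      (\<Sum>l\<le>Suc a. ?C a l * (?u l * ?v (Suc a - l)))"
    by (simp add: Const_simps binomial_eq_0)
  also have "\<dots> = ?u 0 * ?v (Suc a) + (\<Sum>l\<le>a. ?C a (Suc l) * (?u (Suc l) * ?v (a - l)))"
    by (subst sum.atMost_Suc_shift) (simp add: Const_simps)
  also have "(\<Sum>l\<le>a. ?C a l * (?u (Suc l) * ?v (a - l))) +
      (?u 0 * ?v (Suc a) + (\<Sum>l\<le>a. ?C a (Suc l) * (?u (Suc l) * ?v (a - l)))) =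
      ?u 0 * ?v (Suc a) + (\<Sum>l\<le>a. ?C (Suc a) (Suc l) * (?u (Suc l) * ?v (a - l)))"
    by (simp add: Const_simps algebra_simps sum.distrib)
  also have "\<dots> = (\<Sum>l\<le>Suc a. ?C (Suc a) l * (?u l * ?v (Suc a - l)))"
    by (subst sum.atMost_Suc_shift) (simp add: Const_simps)
  finally show ?case .
qed

text \<open>These index the coproduct of an ordered monomial: all pairs \<open>(bs, cs)\<close> with
  entrywise sum \<open>as\<close>.\<close>

fun splits :: "nat list \<Rightarrow> (nat list \<times> nat list) set" where
  "splits [] = {([], [])}"
| "splits (a # as) = (\<lambda>(l, bs, cs). (l # bs, (a - l) # cs)) ` ({..a} \<times> splits as)"

text \<open>Expressed through \<open>bs\<close> and \<open>cs\<close> alone, because the coefficient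
  \<open>\<kappa>\<close> in \<open>slp_apply_operators\<close> is a function of the pair.\<close>

fun binom_prod :: "nat list \<Rightarrow> nat list \<Rightarrow> nat" where
  "binom_prod (b # bs) (c # cs) = (b + c choose b) * binom_prod bs cs"
| "binom_prod bs cs = 1"

text \<open>The Leibniz rule is applied letter by letter, starting from the last; the binomial
  coefficients are constants and pass through the powers in front.\<close>

lemma pbw_mult:
  assumes "length as = length es"
  shows "pbw k d es as (p * q) =
    (\<Sum>(bs, cs)\<in>splits as. Const (of_nat (binom_prod bs cs)) * (pbw k d es bs p * pbw k d es cs q))"
  using assms
proof (induction as es rule: list_induct2)
  case Nil
  then show ?case by (simp add: Const_simps)
next
  case (Cons a as e es)
  obtain i j where e: "e = (i, j)" by (cases e)
  let ?E = "E_act k d i j" and ?P = "pbw k d"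
  have "(?E ^^ a) (Const (of_nat n) * (f * g)) =
      (\<Sum>l\<le>a. Const (of_nat ((a choose l) * n)) * ((?E ^^ l) f * (?E ^^ (a - l)) g))" for n f g
    by (subst funpow_E_act_Const_mult, subst funpow_E_act_mult)
      (simp add: sum_distrib_left Const_simps ac_simps)
  then have "?P (e # es) (a # as) (p * q) = (\<Sum>x\<in>splits as. \<Sum>l\<le>a.
      Const (of_nat ((a choose l) * binom_prod (fst x) (snd x))) *
       ((?E ^^ l) (?P es (fst x) p) * (?E ^^ (a - l)) (?P es (snd x) q)))"
    by (simp add: e Cons.IH funpow_E_act_sum case_prod_unfold del: of_nat_mult)
  also have "\<dots> = (\<Sum>l\<le>a. \<Sum>x\<in>splits as.
      Const (of_nat ((a choose l) * binom_prod (fst x) (snd x))) *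
       ((?E ^^ l) (?P es (fst x) p) * (?E ^^ (a - l)) (?P es (snd x) q)))"
    by (rule sum.swap)
  also have "\<dots> = (\<Sum>(l, bs, cs)\<in>{..a} \<times> splits as.
      Const (of_nat (binom_prod (l # bs) ((a - l) # cs))) *
       (?P (e # es) (l # bs) p * ?P (e # es) ((a - l) # cs) q))"
    unfolding sum.cartesian_product
    by (intro sum.cong refl) (auto simp: e)
  also have "\<dots> = (\<Sum>(bs, cs)\<in>splits (a # as).
      Const (of_nat (binom_prod bs cs)) * (?P (e # es) bs p * ?P (e # es) cs q))"
    unfolding splits.simps
    by (subst sum.reindex) (auto simp: inj_on_def case_prod_unfold simp del: binom_prod.simps)
  finally show ?case .
qed

lemma splits_finite: "finite (splits as)"
  by (induction as) auto

lemma splits_nonempty: "splits as \<noteq> {}"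
  by (induction as) auto

lemma splitsD:
  assumes "(bs, cs) \<in> splits as"
  shows "length bs = length as" "length cs = length as" "sum_list bs + sum_list cs = sum_list as"
    "map2 (+) bs cs = as"
proof -
  have "length bs = length as \<and> length cs = length as \<and> sum_list bs + sum_list cs = sum_list as \<and>
      map2 (+) bs cs = as"
    using assms by (induction as arbitrary: bs cs) fastforce+
  then show "length bs = length as" "length cs = length as" "sum_list bs + sum_list cs = sum_list as"
    "map2 (+) bs cs = as" by auto
qed


subsection \<open>Counting exponents\<close>

definition exponents :: "nat \<Rightarrow> nat \<Rightarrow> nat list set" where
  "exponents n l = {as. length as = n \<and> sum_list as \<le> l}"

lemma finite_exponents: "finite (exponents n l)"
proof (rule finite_subset)
  show "exponents n l \<subseteq> {as. set as \<subseteq> {..l} \<and> length as = n}"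
    by (auto simp: exponents_def dest: member_le_sum_list)
qed (simp add: finite_lists_length_eq)

text \<open>Stars and bars: the slack \<open>l - sum_list as\<close>, taken as an extra entry, turns
  the inequality into an equation.\<close>

lemma card_exponents: "card (exponents n l) = (l + n) choose n"
proof -
  have "bij_betw (\<lambda>as. (l - sum_list as) # as) (exponents n l)
      {as. length as = Suc n \<and> sum_list as = l}"
    by (rule bij_betwI[where g = tl]) (auto simp: exponents_def length_Suc_conv)
  then have "card (exponents n l) = card {as::nat list. length as = Suc n \<and> sum_list as = l}"
    by (rule bij_betw_same_card)
  also have "\<dots> = (l + n) choose l" by (simp add: card_length_sum_list)
  also have "\<dots> = (l + n) choose n" by (subst binomial_symmetric) auto
  finally show ?thesis .
qed

text \<open>Concatenating \<open>bs\<close> and \<open>cs\<close> gives a list of length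
  \<open>2 * n\<close> with the same total as \<open>as\<close>. The map is injective, since
  \<open>as\<close> is recovered as the entrywise sum.\<close>

lemma card_splits_sum: "(\<Sum>as\<in>exponents n l. card (splits as)) \<le> (l + 2 * n) choose (2 * n)"
proof -
  have "(\<Sum>as\<in>exponents n l. card (splits as)) = card (SIGMA as:exponents n l. splits as)"
    by (simp add: finite_exponents splits_finite)
  also have "\<dots> \<le> card (exponents (2 * n) l)"
  proof (rule card_inj_on_le[where f = "\<lambda>(as, bs, cs). bs @ cs"])
    show "inj_on (\<lambda>(as, bs, cs). bs @ cs) (SIGMA as:exponents n l. splits as)"
    proof (rule inj_onI, clarsimp)
      fix as bs cs as' bs' cs'
      assume as: "as \<in> exponents n l" "as' \<in> exponents n l" and eq: "bs @ cs = bs' @ cs'"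
        and splits: "(bs, cs) \<in> splits as" "(bs', cs') \<in> splits as'"
      have "length bs = length bs'"
        using as splitsD(1)[OF splits(1)] splitsD(1)[OF splits(2)] by (simp add: exponents_def)
      with eq have "bs = bs' \<and> cs = cs'" by simp
      with splits show "as = as' \<and> bs = bs' \<and> cs = cs'" by (auto dest: splitsD(4))
    qed
    show "(\<lambda>(as, bs, cs). bs @ cs) ` (SIGMA as:exponents n l. splits as) \<subseteq> exponents (2 * n) l"
      by (auto simp: exponents_def splitsD(1,2)) (metis splitsD(3))
  qed (rule finite_exponents)
  finally show ?thesis by (simp add: card_exponents)
qed

text \<open>Passing from \<open>m\<close> to \<open>m + 1\<close> multiplies the binomial
  coefficient by \<open>(l + m + 1) / (m + 1)\<close>, which is at most \<open>l\<close> once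
  \<open>m \<ge> 1\<close>. The first step gives \<open>l + 1\<close> instead, and this causes the
  factor \<open>3/2\<close>.\<close>

lemma choose_le_power:
  fixes l :: nat
  assumes "l \<ge> 2"
  shows "2 * ((l + m) choose m) \<le> 3 * l ^ m"
proof (induction m)
  case 0
  then show ?case by simp
next
  case (Suc m)
  show ?case
  proof (cases m)
    case 0
    then show ?thesis using assms by simp
  next
    case (Suc m')
    have "Suc m * (2 * ((l + Suc m) choose Suc m)) = Suc (l + m) * (2 * ((l + m) choose m))"
      using Suc_times_binomial[of m "l + m"] by (metis add_Suc_right mult.left_commute)
    also have "\<dots> \<le> (l * Suc m) * (3 * l ^ m)"
    proof (rule mult_mono[OF _ Suc.IH])
      obtain l' where "l = Suc (Suc l')" using assms by (metis One_nat_def Suc_1 Suc_le_D Suc_le_mono)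
      with Suc show "Suc (l + m) \<le> l * Suc m" by simp
    qed auto
    also have "\<dots> = Suc m * (3 * l ^ Suc m)" by (simp add: algebra_simps)
    finally show ?thesis by (metis Suc_mult_le_cancel1)
  qed
qed


subsection \<open>Normal ordering\<close>

text \<open>\<open>(l, p)\<close> expresses that some element of length at most \<open>l\<close>
  sends \<Delta> to \<open>p\<close>. The length filtration is thus carried over to metapolynomials,
  which avoids computing in the quotient ring.\<close>

inductive_set filtration :: "nat \<Rightarrow> nat \<Rightarrow> metapoly \<Rightarrow> (nat \<times> metapoly) set" for k d \<Delta> where
  base: "(0, \<Delta>) \<in> filtration k d \<Delta>"
| act: "(l, p) \<in> filtration k d \<Delta> \<Longrightarrow> i < k \<Longrightarrow> j < k \<Longrightarrow> (Suc l, E_act k d i j p) \<in> filtration k d \<Delta>"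
| lift: "(l, p) \<in> filtration k d \<Delta> \<Longrightarrow> (Suc l, p) \<in> filtration k d \<Delta>"
| add: "(l, p) \<in> filtration k d \<Delta> \<Longrightarrow> (l, q) \<in> filtration k d \<Delta> \<Longrightarrow> (l, p + q) \<in> filtration k d \<Delta>"
| scal: "(l, p) \<in> filtration k d \<Delta> \<Longrightarrow> (l, Const x * p) \<in> filtration k d \<Delta>"

inductive_set pbw_span :: "nat \<Rightarrow> nat \<Rightarrow> (nat \<times> nat) list \<Rightarrow> metapoly \<Rightarrow> nat \<Rightarrow> metapoly set"
  for k d es \<Delta> l where
  base: "as \<in> exponents (length es) l \<Longrightarrow> pbw k d es as \<Delta> \<in> pbw_span k d es \<Delta> l"
| add: "p \<in> pbw_span k d es \<Delta> l \<Longrightarrow> q \<in> pbw_span k d es \<Delta> l \<Longrightarrow> p + q \<in> pbw_span k d es \<Delta> l"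
| scal: "p \<in> pbw_span k d es \<Delta> l \<Longrightarrow> Const x * p \<in> pbw_span k d es \<Delta> l"

lemma filtration_mono: "(l, p) \<in> filtration k d \<Delta> \<Longrightarrow> l \<le> m \<Longrightarrow> (m, p) \<in> filtration k d \<Delta>"
  by (rotate_tac 1, induction rule: dec_induct) (auto intro: filtration.lift)

lemma filtration_0: "(l, 0) \<in> filtration k d \<Delta>"
  using filtration_mono[OF filtration.scal[OF filtration.base[of \<Delta> k d], of 0], of l]
  by (simp add: Const_simps)

lemma Const_minus_1_mult: "Const (- 1) * p = - p"
  using Const_simps(4)[of 0 1] by (simp add: Const_simps)

lemma filtration_diff:
  assumes "(l, p) \<in> filtration k d \<Delta>" "(l, q) \<in> filtration k d \<Delta>"
  shows "(l, p - q) \<in> filtration k d \<Delta>"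
  using filtration.add[OF assms(1) filtration.scal[OF assms(2), of "- 1"]]
  by (simp add: Const_minus_1_mult)

lemma filtration_sum:
  assumes "\<And>x. x \<in> A \<Longrightarrow> (l, f x) \<in> filtration k d \<Delta>"
  shows "(l, sum f A) \<in> filtration k d \<Delta>"
  using assms by (induction A rule: infinite_finite_induct) (auto intro: filtration_0 filtration.add)

lemma funpow_E_act_filtration:
  assumes "(l, p) \<in> filtration k d \<Delta>" "i < k" "j < k"
  shows "(l + a, (E_act k d i j ^^ a) p) \<in> filtration k d \<Delta>"
  using assms by (induction a) (auto intro: filtration.act)

lemma pbw_filtration:
  assumes "length as = length es" "set es \<subseteq> {..<k} \<times> {..<k}"
  shows "(sum_list as, pbw k d es as \<Delta>) \<in> filtration k d \<Delta>"
  using assms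
proof (induction as es rule: list_induct2)
  case (Cons a as e es)
  then show ?case
    using funpow_E_act_filtration[of "sum_list as" "pbw k d es as \<Delta>" k d \<Delta> "fst e" "snd e" a]
    by (cases e) (auto simp: add.commute)
qed (auto intro: filtration.base)

lemma word_act_filtration:
  "set w \<subseteq> {..<k} \<times> {..<k} \<Longrightarrow> (length w, word_act k d w \<Delta>) \<in> filtration k d \<Delta>"
  by (induction w) (auto intro: filtration.base filtration.act)

text \<open>Each of the two products raises the level by two, but the bracket is a combination of
  single letters and raises it only by one. This drop is what makes normal ordering
  terminate.\<close>

lemma E_act_commutator_filtration:
  assumes "(n, p) \<in> filtration k d \<Delta>" "i < k" "j < k" "l < k" "m < k"
  shows "(Suc n, E_act k d i j (E_act k d l m p) - E_act k d l m (E_act k d i j p))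
    \<in> filtration k d \<Delta>"
  unfolding E_act_commutator[OF assms(2,4)]
  using assms by (intro filtration_diff) (auto intro: filtration.act filtration_0)

lemma funpow_commutator_filtration:
  assumes "(n, p) \<in> filtration k d \<Delta>" "i < k" "j < k" "l < k" "m < k"
  shows "(n + a, E_act k d i j ((E_act k d l m ^^ a) p) - (E_act k d l m ^^ a) (E_act k d i j p))
    \<in> filtration k d \<Delta>"
proof (induction a)
  case 0
  then show ?case by (simp add: filtration_0)
next
  case (Suc a)
  let ?E = "E_act k d i j" and ?F = "E_act k d l m"
  let ?q = "(?F ^^ a) p"
  \<comment> \<open>This is \<open>[E, F^(a+1)] = [E, F] F^a + F [E, F^a]\<close>, applied to
    \<open>p\<close>.\<close>
  have "(Suc (n + a), (?E (?F ?q) - ?F (?E ?q)) + ?F (?E ?q - (?F ^^ a) (?E p)))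
      \<in> filtration k d \<Delta>"
    using assms Suc
    by (intro filtration.add E_act_commutator_filtration filtration.act funpow_E_act_filtration) auto
  then show ?case using funpow_E_act_diff[of 1 k d l m] by simp
qed

text \<open>The new letter is commuted past the powers in front of the first \<open>(i, j)\<close>
  in \<open>es\<close> and raises the exponent there. The corrections arising on the way have level
  \<open>sum_list as\<close>, one below that of the two ordered terms.\<close>

lemma pbw_insert:
  assumes "length as = length es" "set es \<subseteq> {..<k} \<times> {..<k}" "(i, j) \<in> set es"
  shows "\<exists>bs. length bs = length es \<and> sum_list bs = Suc (sum_list as) \<and>
    (sum_list as, E_act k d i j (pbw k d es as \<Delta>) - pbw k d es bs \<Delta>) \<in> filtration k d \<Delta>"
  using assms
proof (induction as es rule: list_induct2)
  case (Cons a as e es)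
  obtain l m where e: "e = (l, m)" by (cases e)
  with Cons.prems have ij: "i < k" "j < k" "l < k" "m < k" and es: "set es \<subseteq> {..<k} \<times> {..<k}"
    by auto
  show ?case
  proof (cases "(i, j) = (l, m)")
    case True
    with Cons.hyps show ?thesis by (intro exI[of _ "Suc a # as"]) (auto simp: e filtration_0)
  next
    case False
    with Cons.prems e have "(i, j) \<in> set es" by auto
    with Cons.IH es obtain bs where bs: "length bs = length es" "sum_list bs = Suc (sum_list as)"
      "(sum_list as, E_act k d i j (pbw k d es as \<Delta>) - pbw k d es bs \<Delta>) \<in> filtration k d \<Delta>"
      by blast
    let ?E = "E_act k d i j" and ?F = "E_act k d l m ^^ a"
    let ?q = "pbw k d es as \<Delta>"
    have "(sum_list as, ?q) \<in> filtration k d \<Delta>" by (rule pbw_filtration) (use Cons.hyps es in auto)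
    \<comment> \<open>The first summand is the cost of passing the leading power; the second is that
      power applied to the correction from the induction hypothesis.\<close>
    then have "(sum_list as + a, (?E (?F ?q) - ?F (?E ?q)) + ?F (?E ?q - pbw k d es bs \<Delta>))
        \<in> filtration k d \<Delta>"
      using ij bs(3)
      by (intro filtration.add funpow_commutator_filtration funpow_E_act_filtration) auto
    with bs show ?thesis
      by (intro exI[of _ "a # bs"]) (auto simp: e funpow_E_act_diff add.commute)
  qed
qed simp

lemma pbw_span_mono:
  "p \<in> pbw_span k d es \<Delta> l \<Longrightarrow> l \<le> m \<Longrightarrow> p \<in> pbw_span k d es \<Delta> m"
  by (induction rule: pbw_span.induct) (auto intro: pbw_span.intros simp: exponents_def)

text \<open>\<open>lower\<close> will be the induction hypothesis of
  \<open>filtration_imp_pbw_span\<close>; it brings the correction from \<open>pbw_insert\<close>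
  into normal order.\<close>

lemma E_act_pbw_span:
  assumes es: "set es = {..<k} \<times> {..<k}" and ij: "i < k" "j < k"
    and lower: "\<And>p. (l, p) \<in> filtration k d \<Delta> \<Longrightarrow> p \<in> pbw_span k d es \<Delta> l"
    and "p \<in> pbw_span k d es \<Delta> l"
  shows "E_act k d i j p \<in> pbw_span k d es \<Delta> (Suc l)"
  using assms(5)
proof (induction rule: pbw_span.induct)
  case (base as)
  then have as: "length as = length es" "sum_list as \<le> l" by (auto simp: exponents_def)
  from pbw_insert[OF as(1)] es ij obtain bs where bs: "length bs = length es"
    "sum_list bs = Suc (sum_list as)"
    "(sum_list as, E_act k d i j (pbw k d es as \<Delta>) - pbw k d es bs \<Delta>) \<in> filtration k d \<Delta>"
    by blast
  then have "E_act k d i j (pbw k d es as \<Delta>) - pbw k d es bs \<Delta> \<in> pbw_span k d es \<Delta> (Suc l)"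
    using as(2) lower filtration_mono pbw_span_mono by (meson le_SucI le_refl)
  moreover have "pbw k d es bs \<Delta> \<in> pbw_span k d es \<Delta> (Suc l)"
    using bs as(2) by (intro pbw_span.base) (auto simp: exponents_def)
  ultimately show ?case using pbw_span.add by fastforce
qed (auto simp: E_act_add E_act_Const_mult intro: pbw_span.add pbw_span.scal)

lemma filtration_imp_pbw_span:
  assumes es: "set es = {..<k} \<times> {..<k}"
  shows "(l, p) \<in> filtration k d \<Delta> \<Longrightarrow> p \<in> pbw_span k d es \<Delta> l"
proof (induction l arbitrary: p rule: less_induct)
  case (less l)
  \<comment> \<open>The rule induction runs through lower levels, hence the general
    \<open>m \<le> l\<close>. Rule \<open>act\<close> ends at level \<open>Suc m \<le> l\<close>, so
    the outer induction hypothesis applies at level \<open>m\<close> and supplies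
    \<open>lower\<close>.\<close>
  have "p \<in> pbw_span k d es \<Delta> m" if "(m, p) \<in> filtration k d \<Delta>" "m \<le> l" for p m
    using that
  proof (induction rule: filtration.induct)
    case base
    show ?case using pbw_span.base[of "replicate (length es) 0" es 0 k d \<Delta>]
      by (simp add: pbw_replicate_0 exponents_def sum_list_replicate)
  next
    case (act m p i j)
    then show ?case using es less.IH[of m] by (intro E_act_pbw_span) auto
  next
    case (lift m p)
    then show ?case by (auto intro: pbw_span_mono)
  qed (auto intro: pbw_span.add pbw_span.scal)
  with less.prems show ?case by blast
qed

lemma pbw_span_sum:
  assumes "p \<in> pbw_span k d es \<Delta> l"
  shows "\<exists>x. p = (\<Sum>as\<in>exponents (length es) l. Const (x as) * pbw k d es as \<Delta>)"
  using assms
proof (induction rule: pbw_span.induct)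
  case (base as)
  have "(\<Sum>bs\<in>exponents (length es) l. Const (if bs = as then 1 else 0) * pbw k d es bs \<Delta>) =
      (\<Sum>bs\<in>exponents (length es) l. if bs = as then pbw k d es bs \<Delta> else 0)"
    by (intro sum.cong) (auto simp: Const_simps)
  with base show ?case
    by (intro exI[of _ "\<lambda>bs. if bs = as then 1 else 0"]) (simp add: finite_exponents)
next
  case (add p q)
  then obtain x y where
    "p = (\<Sum>as\<in>exponents (length es) l. Const (x as) * pbw k d es as \<Delta>)"
    "q = (\<Sum>as\<in>exponents (length es) l. Const (y as) * pbw k d es as \<Delta>)" by blast
  then show ?case
    by (intro exI[of _ "\<lambda>as. x as + y as"]) (simp add: Const_simps distrib_right sum.distrib)
next
  case (scal p y)
  then obtain x where "p = (\<Sum>as\<in>exponents (length es) l. Const (x as) * pbw k d es as \<Delta>)" by blast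
  then show ?case
    by (intro exI[of _ "\<lambda>as. y * x as"]) (simp add: Const_simps sum_distrib_left mult.assoc)
qed


subsection \<open>The size bound\<close>

lemma uea_length_representative:
  assumes "P \<in> carrier (uea k)"
  obtains t where "t \<in> carrier (tensor_alg k)" "\<And>w. w \<in> Poly_Mapping.keys t \<Longrightarrow> length w \<le> uea_length k P"
    "\<And>d \<Delta>. uea_act k d P \<Delta> = tensor_act k d t \<Delta>"
proof -
  let ?Q = "\<lambda>l. \<exists>t\<in>carrier (tensor_alg k).
     (\<forall>w\<in>Poly_Mapping.keys t. length w \<le> l) \<and> P = uea_ideal k +>\<^bsub>tensor_alg k\<^esub> t"
  obtain u where u: "u \<in> carrier (tensor_alg k)" "P = uea_ideal k +>\<^bsub>tensor_alg k\<^esub> u"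
    using assms by (auto simp: uea_def FactRing_def A_RCOSETS_def')
  \<comment> \<open>For \<open>u = 0\<close> this is the maximum of an empty set, but then the
    condition on words is vacuous.\<close>
  then have "?Q (Max (length ` Poly_Mapping.keys u))" by (intro bexI[of _ u]) auto
  then have "?Q (uea_length k P)" unfolding uea_length_def by (rule LeastI)
  then obtain t where t: "t \<in> carrier (tensor_alg k)"
    "\<And>w. w \<in> Poly_Mapping.keys t \<Longrightarrow> length w \<le> uea_length k P"
    "P = uea_ideal k +>\<^bsub>tensor_alg k\<^esub> t" by blast
  have "\<zero>\<^bsub>tensor_alg k\<^esub> \<in> uea_ideal k"
    by (auto simp: uea_ideal_def genideal_def intro: additive_subgroup.zero_closed ideal.axioms(1))
  then have "\<zero>\<^bsub>tensor_alg k\<^esub> \<oplus>\<^bsub>tensor_alg k\<^esub> t \<in> P" unfolding t(3) a_r_coset_def' by blast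
  then have "t \<in> P" by (simp add: tensor_alg_def)
  with that t assms show ?thesis by (simp add: uea_act_eq)
qed

text \<open>
  Here the normally ordered products would cost a factor depending on \<open>k\<close>; instead the linear
  part of \<open>t\<close> is treated as a single derivation.
\<close>

lemma circuit_act_length_le_1:
  assumes t: "t \<in> carrier (tensor_alg k)" "\<And>w. w \<in> Poly_Mapping.keys t \<Longrightarrow> length w \<le> 1"
    and C: "is_circuit k d C" "computes C \<Delta>"
  shows "\<exists>C'. is_circuit k d C' \<and> computes C' (tensor_act k d t \<Delta>) \<and>
    circuit_size C' \<le> 18 * circuit_size C"
proof -
  define W where "W = {w \<in> Poly_Mapping.keys t. length w = 1}"
  define X where "X p = (\<Sum>w\<in>W. Const (Poly_Mapping.lookup t w) * word_act k d w p)" for p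
  have W: "\<exists>i j. w = [(i, j)] \<and> i < k \<and> j < k" if "w \<in> W" for w
    using that t(1) by (fastforce simp: W_def tensor_alg_def length_Suc_conv)
  have X_add: "X (p + q) = X p + X q" for p q
    by (simp add: X_def word_act_add distrib_left sum.distrib)
  have "word_act k d w (Const x) = 0" if "w \<in> W" for w x
    using W[OF that] by auto
  then have X_Const: "X (Const x) = 0" for x
    by (simp add: X_def)
  have "word_act k d w (p * q) = p * word_act k d w q + word_act k d w p * q" if "w \<in> W" for w p q
    using W[OF that] by (auto simp: E_act_mult)
  then have X_mult: "X (p * q) = p * X q + X p * q" for p q
    by (simp add: X_def distrib_left sum.distrib sum_distrib_left sum_distrib_right ac_simps)
  have X_aff: "X p \<in> affine_metapolys k d" if "p \<in> affine_metapolys k d" for p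
    unfolding X_def
  proof (intro affine_sum affine_Const_mult)
    fix w assume "w \<in> W"
    from W[OF this] that show "word_act k d w p \<in> affine_metapolys k d"
      by (auto intro: E_act_affine)
  qed
  \<comment> \<open>\<open>True\<close> stands for the derivation \<open>X\<close> and
    \<open>False\<close> for the identity, with the coproducts of a primitive element and of the
    unit. These are three pairs in total, whence \<open>6 * 3 = 18\<close>.\<close>
  let ?S = "\<lambda>a. if a then {(False, True), (True, False)} else {(False, False)}"
  let ?D = "\<lambda>a p. if a then X p else p"
  have "\<exists>C'. is_circuit k d C' \<and>
      computes C' (\<Sum>a\<in>UNIV. Const (if a then 1 else Poly_Mapping.lookup t []) * ?D a \<Delta>) \<and>
      circuit_size C' \<le> 6 * circuit_size C * (\<Sum>a\<in>UNIV. card (?S a))"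
    by (rule circuit_apply_operators[where \<kappa> = "\<lambda>_ _. 1"])
      (use C in \<open>auto simp: X_add X_Const X_mult X_aff Const_simps\<close>)
  moreover have "(\<Sum>a\<in>UNIV. card (?S a)) = 3" by (simp add: UNIV_bool)
  moreover have "(\<Sum>a\<in>UNIV. Const (if a then 1 else Poly_Mapping.lookup t []) * ?D a \<Delta>) =
      tensor_act k d t \<Delta>"
  proof -
    have "tensor_act k d t \<Delta> =
        (\<Sum>w\<in>insert [] W. Const (Poly_Mapping.lookup t w) * word_act k d w \<Delta>)"
    proof (rule tensor_act_superset)
      show "Poly_Mapping.keys t \<subseteq> insert [] W"
        using t(2) by (force simp: W_def le_Suc_eq)
    qed (simp add: W_def)
    also have "\<dots> = Const (Poly_Mapping.lookup t []) * \<Delta> + X \<Delta>"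
      by (subst sum.insert) (auto simp: W_def X_def)
    finally show ?thesis by (simp add: UNIV_bool Const_simps)
  qed
  ultimately show ?thesis by simp
qed

text \<open>There are \<open>n = k\<^sup>2\<close> letters, so the number of pairs is at most
  \<open>3/2\<close> times \<open>L ^ (2 * k\<^sup>2)\<close>, and
  \<open>6 * 3/2 = 9\<close>.\<close>

lemma circuit_act_length_ge_2:
  assumes t: "t \<in> carrier (tensor_alg k)" "\<And>w. w \<in> Poly_Mapping.keys t \<Longrightarrow> length w \<le> L"
    and L: "L \<ge> 2" and C: "is_circuit k d C" "computes C \<Delta>"
  shows "\<exists>C'. is_circuit k d C' \<and> computes C' (tensor_act k d t \<Delta>) \<and>
    circuit_size C' \<le> 9 * (circuit_size C * L ^ (2 * k\<^sup>2))"
proof -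
  define es where "es = List.product [0..<k] [0..<k]"
  have es: "set es = {..<k} \<times> {..<k}" "length es = k\<^sup>2"
    by (auto simp: es_def power2_eq_square)
  let ?A = "exponents (length es) L"
  have "(L, tensor_act k d t \<Delta>) \<in> filtration k d \<Delta>"
    unfolding tensor_act_def
  proof (intro filtration_sum filtration.scal)
    fix w assume "w \<in> Poly_Mapping.keys t"
    with t show "(L, word_act k d w \<Delta>) \<in> filtration k d \<Delta>"
      by (intro filtration_mono[OF word_act_filtration]) (auto simp: tensor_alg_def)
  qed
  then obtain x where x: "tensor_act k d t \<Delta> = (\<Sum>as\<in>?A. Const (x as) * pbw k d es as \<Delta>)"
    using filtration_imp_pbw_span[OF es(1)] pbw_span_sum by blast
  have "\<exists>C'. is_circuit k d C' \<and> computes C' (\<Sum>as\<in>?A. Const (x as) * pbw k d es as \<Delta>) \<and>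
      circuit_size C' \<le> 6 * circuit_size C * (\<Sum>as\<in>?A. card (splits as))"
  proof (rule circuit_apply_operators[where \<kappa> = "\<lambda>bs cs. of_nat (binom_prod bs cs)"])
    show "?A \<noteq> {}"
      by (auto simp: exponents_def sum_list_replicate intro!: exI[of _ "replicate (length es) 0"])
    show "splits as \<subseteq> ?A \<times> ?A" if "as \<in> ?A" for as
    proof
      fix y assume "y \<in> splits as"
      then obtain bs cs where y: "y = (bs, cs)" "(bs, cs) \<in> splits as" by (cases y) auto
      from splitsD[OF y(2)] that show "y \<in> ?A \<times> ?A" by (auto simp: y exponents_def)
    qed
    fix as p q y assume "as \<in> ?A"
    then have as: "length as = length es" by (simp add: exponents_def)
    show "pbw k d es as (p + q) = pbw k d es as p + pbw k d es as q" by (rule pbw_add[OF as])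
    show "pbw k d es as (Const y * p) = Const y * pbw k d es as p" by (rule pbw_Const_mult[OF as])
    show "pbw k d es as (p * q) = (\<Sum>(bs, cs)\<in>splits as.
        Const (of_nat (binom_prod bs cs)) * (pbw k d es bs p * pbw k d es cs q))"
      by (rule pbw_mult[OF as])
    show "pbw k d es as p \<in> affine_metapolys k d" if "p \<in> affine_metapolys k d"
      using pbw_affine[OF as _ that] es(1) by simp
  qed (rule finite_exponents splits_finite splits_nonempty C)+
  then obtain C' where C': "is_circuit k d C'" "computes C' (tensor_act k d t \<Delta>)"
    "circuit_size C' \<le> 6 * circuit_size C * (\<Sum>as\<in>?A. card (splits as))"
    unfolding x by blast
  have "2 * (\<Sum>as\<in>?A. card (splits as)) \<le> 3 * L ^ (2 * k\<^sup>2)"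
    using card_splits_sum[of "length es" L] choose_le_power[OF L, of "2 * k\<^sup>2"] by (simp add: es)
  then have "3 * circuit_size C * (2 * (\<Sum>as\<in>?A. card (splits as))) \<le>
      3 * circuit_size C * (3 * L ^ (2 * k\<^sup>2))"
    by (rule mult_left_mono) simp
  with C'(3) have "circuit_size C' \<le> 9 * (circuit_size C * L ^ (2 * k\<^sup>2))" by linarith
  with C' show ?thesis by blast
qed

text \<open>\<open>K\<close> is chosen before \<open>k\<close> and \<open>d\<close>, so it is an
  absolute constant. With \<open>max 1 L\<close> the bound stays positive for \<open>L = 0\<close>,
  where \<open>P\<close> acts as a scalar and a circuit still needs a vertex.\<close>

theorem theorem5p10:
  shows "\<exists>K::real. \<forall>(k::nat) (d::nat) (L::nat) (s::nat) P \<Delta>.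
    P \<in> carrier (uea k) \<longrightarrow> uea_length k P = L \<longrightarrow> \<Delta> \<in> metapolys k d \<longrightarrow>
    (\<exists>C. is_circuit k d C \<and> circuit_size C = s \<and> computes C \<Delta>) \<longrightarrow>
    (\<exists>C'. is_circuit k d C' \<and> computes C' (uea_act k d P \<Delta>) \<and>
       real (circuit_size C') \<le> K * (real s * real (max 1 L) ^ (2 * k\<^sup>2)))"
\<comment> \<open>\<open>18\<close> comes from lengths at most one; from length two on,
  \<open>9\<close> suffices.\<close>
proof (intro exI[of _ 18] allI impI, elim exE conjE)
  fix k d L s P \<Delta> C
  assume P: "P \<in> carrier (uea k)" "uea_length k P = L"
    and C: "is_circuit k d C" "circuit_size C = s" "computes C \<Delta>"
  obtain t where t: "t \<in> carrier (tensor_alg k)" "\<And>w. w \<in> Poly_Mapping.keys t \<Longrightarrow> length w \<le> L"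
    "uea_act k d P \<Delta> = tensor_act k d t \<Delta>"
    using uea_length_representative[OF P(1)] P(2) by metis
  have "\<exists>C'. is_circuit k d C' \<and> computes C' (uea_act k d P \<Delta>) \<and>
      circuit_size C' \<le> 18 * (s * max 1 L ^ (2 * k\<^sup>2))"
  proof (cases "L \<ge> 2")
    case True
    with circuit_act_length_ge_2[OF t(1,2) True C(1,3)] obtain C' where
      "is_circuit k d C'" "computes C' (uea_act k d P \<Delta>)"
      "circuit_size C' \<le> 9 * (s * max 1 L ^ (2 * k\<^sup>2))"
      unfolding t(3) C(2) by (auto simp: max_def)
    then show ?thesis by (intro exI[of _ C']) auto
  next
    case False
    then have "max 1 L = 1" by auto
    then show ?thesis
      using circuit_act_length_le_1[OF t(1) _ C(1,3)] t(2) False unfolding t(3) C(2)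
      by (fastforce dest: t(2))
  qed
  then show "\<exists>C'. is_circuit k d C' \<and> computes C' (uea_act k d P \<Delta>) \<and>
      real (circuit_size C') \<le> 18 * (real s * real (max 1 L) ^ (2 * k\<^sup>2))"
  proof (elim exE conjE, intro exI conjI)
    fix C' assume "circuit_size C' \<le> 18 * (s * max 1 L ^ (2 * k\<^sup>2))"
    then have "real (circuit_size C') \<le> real (18 * (s * max 1 L ^ (2 * k\<^sup>2)))"
      by (rule of_nat_mono)
    then show "real (circuit_size C') \<le> 18 * (real s * real (max 1 L) ^ (2 * k\<^sup>2))" by simp
  qed
qed

end
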